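(* Let $n\ge2$ and $p\in\mathbb{N}$. For any $K\in\mathcal{K}(\mathbb{R}^n)$, one has $$\frac{1}{n+1}\sum_{j=0}^n\binom nj^{-1}V\big(-\Delta_pK[j],K^p[np-j]\big)\leq|K|^p.$$
   Context: $\mathcal{K}(\mathbb{R}^n)$ denotes the set of convex bodies, i.e. nonempty compact convex subsets of $\mathbb{R}^n$; $|\cdot|$ is Lebesgue measure (in the dimension of the ambient space). The mixed volume of $K_1,\dots,K_N\in\mathcal{K}(\mathbb{R}^N)$ is $V(K_1,\dots,K_N)=\frac1{N!}\frac{\partial^N}{\partial t_1\cdots\partial t_N}\big|_{t_1=\dots=t_N=0}|t_1K_1+\dots+t_NK_N|$ (Minkowski sums; the volume is a homogeneous polynomial of degree $N$ in $t_1,\dots,t_N\ge0$). $L[k]$ means that $L$ is repeated $k$ times. Identify $\mathbb{R}^{np}=(\mathbb{R}^n)^p$; $\Delta_p:\mathbb{R}^n\to\mathbb{R}^{np}$, $\Delta_p(x)=(x,\dots,x)$; $-\Delta_pK=\{-\Delta_p(x):x\in K\}$; $K^p=K\times\cdots\times K\subset\mathbb{R}^{np}$. *)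

theory Defs
  imports "HOL-Analysis.Analysis" "HOL-Library.Set_Algebras"
begin

definition convex_body :: "'a::euclidean_space set \<Rightarrow> bool" where
  "convex_body K \<longleftrightarrow> K \<noteq> {} \<and> compact K \<and> convex K"

text \<open>The volume of \<open>t\<^sub>1 K\<^sub>1 + \<dots> + t\<^sub>N K\<^sub>N\<close> is a polynomial in \<open>t\<close> only on the orthant where all
  \<open>t\<^sub>i \<ge> 0\<close>, so partial derivatives are taken relative to that orthant: at a point with \<open>t\<^sub>i = 0\<close> the
  derivative in direction \<open>i\<close> is the one-sided derivative from the right.\<close>

definition orthant_partial :: "nat \<Rightarrow> ((nat \<Rightarrow> real) \<Rightarrow> real) \<Rightarrow> (nat \<Rightarrow> real) \<Rightarrow> real" where
  "orthant_partial i f t = vector_derivative (\<lambda>s. f (t(i := s))) (at (t i) within {0..})"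

text \<open>The list must have length \<open>DIM('a)\<close>; the sum of sets is the Minkowski sum.\<close>

definition mixed_volume :: "'a::euclidean_space set list \<Rightarrow> real" where
  "mixed_volume Ks =
     1 / fact DIM('a) *
     foldr orthant_partial [0..<DIM('a)]
       (\<lambda>t. measure lebesgue (\<Sum>i<DIM('a). (\<lambda>x. t i *\<^sub>R x) ` (Ks ! i)))
       (\<lambda>_. 0)"

definition diagonal_embedding :: "'a \<Rightarrow> 'a ^ 'p" where
  "diagonal_embedding x = (\<chi> i. x)"

definition cartesian_power :: "'a set \<Rightarrow> ('a ^ 'p) set" where
  "cartesian_power K = {x. \<forall>i. x $ i \<in> K}"

end

theory Submission
  imports Defs "HOL-Probability.Distributions"
begin

text \<open>Write \<open>n = CARD('n)\<close>, \<open>p = CARD('p)\<close>, \<open>N = n p\<close>, \<open>A = - \<Delta>\<^sub>p K\<close>, \<open>B = K\<^sup>p\<close>.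

  Minkowski's theorem, that \<open>|sA + tB|\<close> is a homogeneous polynomial, is proved by transport: for finite \<open>V\<close>,
  the gradient of \<open>x \<mapsto> ln (\<Sum>v\<in>V. exp \<langle>v, x\<rangle>)\<close> is monotone with values in the convex hull of \<open>V\<close>.
  Hence \<open>s conv V + t conv W\<close>, thickened by a small ball, is the bijective image of the whole space
  under a gradient map whose Jacobian determinant is a nonnegative polynomial in \<open>s\<close>. Integration and
  approximation of \<open>A\<close>, \<open>B\<close> by finite nets preserve polynomials of bounded degree.

  For the inequality, put \<open>F(s,t) = |sA + tB|\<close>. As in the proof of the Rogers--Shephard inequality,
  integrating \<open>|{x \<in> sK. y\<^sub>i + x \<in> tK for all i}|\<close> over \<open>y\<close> gives
  \<open>\<integral>\<^sub>0\<^bsup>min s t\<^esup> n r\<^bsup>n-1\<^esup> F(s-r, t-r) dr \<le> s\<^sup>n t\<^sup>N |K|\<^sup>p\<close>.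
  The Laplace transform of this convolution inequality reads \<open>\<Sum>\<^sub>j V\<^sub>j x\<^sup>j \<le> (1+x)\<^sup>n |K|\<^sup>p\<close> for \<open>x > 0\<close>, where
  \<open>V\<^sub>j\<close> are the mixed volumes; in particular \<open>V\<^sub>j = 0\<close> for \<open>j > n\<close>. Substituting
  \<open>x = (1-u)/u\<close>, multiplying by \<open>u\<^sup>n\<close> and integrating over \<open>u \<in> (0,1)\<close> produces the weights
  \<open>1 / ((n+1) (n choose j))\<close>.\<close>

section \<open>Polynomials of bounded degree\<close>

text \<open>The nodes 0, ..., \<open>N\<close> are nonnegative, so the interpolant uses only values
  of \<open>f\<close> on the half-line on which \<open>poly_on_nonneg\<close> says anything.\<close>

definition lagrange_interpolation :: "nat \<Rightarrow> (real \<Rightarrow> real) \<Rightarrow> real poly" where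
  "lagrange_interpolation N f =
     (\<Sum>i\<le>N. smult (f (real i)) (\<Prod>m\<in>{..N} - {i}. smult (1 / (real i - real m)) [:- real m, 1:]))"

lemma poly_lagrange_interpolation:
  "poly (lagrange_interpolation N f) s =
     (\<Sum>i\<le>N. f (real i) * (\<Prod>m\<in>{..N} - {i}. (s - real m) / (real i - real m)))"
  by (simp add: lagrange_interpolation_def poly_sum poly_prod diff_divide_distrib)

lemma degree_lagrange_interpolation: "degree (lagrange_interpolation N f) \<le> N"
  unfolding lagrange_interpolation_def
proof (intro degree_sum_le)
  fix i assume i: "i \<in> {..N}"
  have "degree (\<Prod>m\<in>{..N} - {i}. smult (1 / (real i - real m)) [:- real m, 1:]) \<le>
    (\<Sum>m\<in>{..N} - {i}. degree (smult (1 / (real i - real m)) [:- real m, 1:]))"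
    by (rule degree_prod_sum_le[unfolded o_def]) auto
  also have "\<dots> \<le> (\<Sum>m\<in>{..N} - {i}. 1)"
    by (intro sum_mono order_trans[OF degree_smult_le]) simp
  finally show "degree (smult (f (real i)) (\<Prod>m\<in>{..N} - {i}. smult (1 / (real i - real m)) [:- real m, 1:])) \<le> N"
    using i by auto
qed auto

lemma lagrange_interpolation_node:
  assumes "k \<le> N"
  shows "poly (lagrange_interpolation N f) (real k) = f (real k)"
proof -
  have "(\<Prod>m\<in>{..N} - {i}. (real k - real m) / (real i - real m)) = (if i = k then 1 else 0)" for i
  proof (cases "i = k")
    case False
    have "(\<Prod>m\<in>{..N} - {i}. (real k - real m) / (real i - real m)) = 0"
      by (rule prod_zero) (use assms False in auto)
    then show ?thesis using False by simp
  qed (auto intro!: prod.neutral)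
  then show ?thesis
    using assms by (simp add: poly_lagrange_interpolation if_distrib[of "(*) _"] cong: if_cong)
qed

lemma lagrange_interpolation_poly:
  assumes "degree p \<le> N"
  shows "lagrange_interpolation N (poly p) = p"
proof (rule poly_eqI_degree[where A="real ` {..N}"])
  have "card (real ` {..N}) = Suc N" by (simp add: card_image)
  then show "degree (lagrange_interpolation N (poly p)) < card (real ` {..N})"
    "degree p < card (real ` {..N})"
    using degree_lagrange_interpolation[of N "poly p"] assms by auto
qed (auto simp: lagrange_interpolation_node)

text \<open>Being equal to one's own Lagrange interpolant is a linear condition on finitely many values, hence
  it survives pointwise limits and integrals over a parameter.\<close>

definition poly_on_nonneg :: "nat \<Rightarrow> (real \<Rightarrow> real) \<Rightarrow> bool" where
  "poly_on_nonneg N f \<longleftrightarrow> (\<exists>p. degree p \<le> N \<and> (\<forall>s\<ge>0. f s = poly p s))"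

lemma poly_on_nonneg_iff:
  "poly_on_nonneg N f \<longleftrightarrow> (\<forall>s\<ge>0. f s = poly (lagrange_interpolation N f) s)"
proof
  assume "poly_on_nonneg N f"
  then obtain p where p: "degree p \<le> N" "\<And>s. s \<ge> 0 \<Longrightarrow> f s = poly p s"
    unfolding poly_on_nonneg_def by blast
  have "lagrange_interpolation N f = lagrange_interpolation N (poly p)"
    unfolding lagrange_interpolation_def by (simp add: p(2))
  then show "\<forall>s\<ge>0. f s = poly (lagrange_interpolation N f) s"
    using p by (simp add: lagrange_interpolation_poly)
qed (use degree_lagrange_interpolation poly_on_nonneg_def in blast)

lemma poly_on_nonneg_LIMSEQ:
  assumes "\<And>k. poly_on_nonneg N (f k)"
    and "\<And>s. s \<ge> 0 \<Longrightarrow> (\<lambda>k. f k s) \<longlonglongrightarrow> g s"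
  shows "poly_on_nonneg N g"
  unfolding poly_on_nonneg_iff
proof (intro allI impI)
  fix s :: real assume s: "s \<ge> 0"
  have "(\<lambda>k. poly (lagrange_interpolation N (f k)) s) \<longlonglongrightarrow> poly (lagrange_interpolation N g) s"
    unfolding poly_lagrange_interpolation by (intro tendsto_intros assms(2)) auto
  moreover have "(\<lambda>k. poly (lagrange_interpolation N (f k)) s) = (\<lambda>k. f k s)"
    using assms(1) s unfolding poly_on_nonneg_iff by auto
  ultimately show "g s = poly (lagrange_interpolation N g) s"
    using assms(2)[OF s] LIMSEQ_unique by auto
qed

lemma poly_on_nonneg_has_integral:
  fixes f :: "'a::euclidean_space \<Rightarrow> real \<Rightarrow> real"
  assumes "\<And>x. x \<in> S \<Longrightarrow> poly_on_nonneg N (f x)"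
    and "\<And>s. s \<ge> 0 \<Longrightarrow> ((\<lambda>x. f x s) has_integral g s) S"
  shows "poly_on_nonneg N g"
  unfolding poly_on_nonneg_iff
proof (intro allI impI)
  fix s :: real assume s: "s \<ge> 0"
  have "((\<lambda>x. poly (lagrange_interpolation N (f x)) s) has_integral
      poly (lagrange_interpolation N g) s) S"
    unfolding poly_lagrange_interpolation
    by (intro has_integral_sum has_integral_mult_left assms(2)) auto
  then have "((\<lambda>x. f x s) has_integral poly (lagrange_interpolation N g) s) S"
    by (rule has_integral_eq[rotated]) (use assms(1) s in \<open>auto simp: poly_on_nonneg_iff\<close>)
  then show "g s = poly (lagrange_interpolation N g) s"
    using assms(2)[OF s] has_integral_unique by blast
qed

text \<open>Leibniz expansion: every entry is affine in \<open>s\<close>, so each permutation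
  contributes a product of \<open>CARD('m)\<close> factors of degree at most 1.\<close>

lemma poly_on_nonneg_det:
  fixes A B :: "real ^ 'm ^ 'm"
  shows "poly_on_nonneg CARD('m) (\<lambda>s. det (s *\<^sub>R A + B))"
proof -
  define p where "p = (\<Sum>\<sigma> | \<sigma> permutes (UNIV :: 'm set). smult (of_int (sign \<sigma>))
     (\<Prod>i\<in>UNIV. [:B $ i $ \<sigma> i, A $ i $ \<sigma> i:]))"
  have "degree p \<le> CARD('m)"
    unfolding p_def
  proof (intro degree_sum_le)
    fix \<sigma> assume "\<sigma> \<in> {\<sigma>. \<sigma> permutes (UNIV :: 'm set)}"
    have "degree (\<Prod>i\<in>UNIV. [:B $ i $ \<sigma> i, A $ i $ \<sigma> i:]) \<le> (\<Sum>i\<in>UNIV. degree [:B $ i $ \<sigma> i, A $ i $ \<sigma> i:])"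
      by (rule degree_prod_sum_le[unfolded o_def]) auto
    also have "\<dots> \<le> (\<Sum>i\<in>(UNIV :: 'm set). 1)"
      by (intro sum_mono) (simp add: degree_pCons_eq_if)
    finally show "degree (smult (of_int (sign \<sigma>)) (\<Prod>i\<in>UNIV. [:B $ i $ \<sigma> i, A $ i $ \<sigma> i:])) \<le> CARD('m)"
      by (intro order_trans[OF degree_smult_le]) simp
  qed (simp add: finite_permutations)
  moreover have "det (s *\<^sub>R A + B) = poly p s" for s
    by (simp add: det_def p_def poly_sum poly_prod algebra_simps)
  ultimately show ?thesis unfolding poly_on_nonneg_def by blast
qed

section \<open>Jacobians of monotone maps\<close>

text \<open>On the segment from the identity to \<open>matrix f\<close> the determinant starts at 1.
  If it ended negative, it would vanish at some u < 1, and a kernel vector x would satisfy 0 = (1-u)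
  |x|^2 + u <f x, x>, whose right-hand side is positive.\<close>

lemma det_nonneg_of_monotone:
  fixes f :: "real ^ 'm \<Rightarrow> real ^ 'm"
  assumes "linear f" and "\<And>h. f h \<bullet> h \<ge> 0"
  shows "det (matrix f) \<ge> 0"
proof (rule ccontr)
  assume neg: "\<not> det (matrix f) \<ge> 0"
  define M where "M u = (1 - u) *\<^sub>R mat 1 + u *\<^sub>R matrix f" for u :: real
  have "continuous_on {0..1} (\<lambda>u. det (M u))"
    unfolding det_def M_def by (intro continuous_intros)
  then obtain u where u: "0 \<le> u" "u \<le> 1" "det (M u) = 0"
    using IVT2'[of "\<lambda>u. det (M u)" 1 0 0] neg by (auto simp: M_def)
  then have "u < 1" using neg by (cases "u = 1") (auto simp: M_def)
  obtain x where x: "x \<noteq> 0" "M u *v x = 0"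
    using u(3) by (metis invertible_def invertible_det_nz matrix_left_invertible_ker matrix_left_right_inverse)
  have "M u *v x = (1 - u) *\<^sub>R x + u *\<^sub>R f x"
    by (simp add: M_def matrix_vector_mult_add_rdistrib scaleR_matrix_vector_assoc[symmetric]
        fun_cong[OF matrix_vector_mul(2)[OF assms(1)]])
  then have "0 = (1 - u) * (x \<bullet> x) + u * (f x \<bullet> x)"
    using x(2) by (metis inner_add_left inner_scaleR_left inner_zero_left)
  moreover have "(1 - u) * (x \<bullet> x) > 0" using \<open>u < 1\<close> x by simp
  moreover have "u * (f x \<bullet> x) \<ge> 0" using assms(2) u by simp
  ultimately show False by linarith
qed

text \<open>The quadratic form at \<open>h\<close> is the limit, as u decreases to 0, of <f (x + u
  h) - f x, h> / u, and monotonicity applied to the points x + u h and x makes each of these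
  quotients nonnegative.\<close>

lemma derivative_of_monotone:
  fixes f :: "'a::real_inner \<Rightarrow> 'a"
  assumes f: "(f has_derivative f') (at x)" and mono: "\<And>y. (f y - f x) \<bullet> (y - x) \<ge> 0"
  shows "f' h \<bullet> h \<ge> 0"
proof -
  interpret f': bounded_linear f' using f by (rule has_derivative_bounded_linear)
  have "((\<lambda>u. f (x + u *\<^sub>R h)) has_derivative (\<lambda>u. f' (u *\<^sub>R h))) (at 0)"
    by (rule has_derivative_compose[where g=f, of "\<lambda>u. x + u *\<^sub>R h", simplified])
      (use f in \<open>auto intro!: derivative_eq_intros\<close>)
  then have *: "((\<lambda>u. f (x + u *\<^sub>R h) \<bullet> h) has_derivative (\<lambda>u. f' (u *\<^sub>R h) \<bullet> h)) (at 0)"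
    by (auto intro!: derivative_eq_intros)
  have "((\<lambda>u. f (x + u *\<^sub>R h) \<bullet> h) has_real_derivative (f' h \<bullet> h)) (at 0)"
  proof -
    have "(\<lambda>u. f' (u *\<^sub>R h) \<bullet> h) = (*) (f' h \<bullet> h)"
      by (simp add: fun_eq_iff f'.scaleR)
    with * show ?thesis by (simp add: has_field_derivative_def)
  qed
  then have "((\<lambda>u. (f (x + u *\<^sub>R h) \<bullet> h - f x \<bullet> h) / u) \<longlongrightarrow> f' h \<bullet> h) (at 0)"
    by (simp add: has_field_derivative_iff)
  then have "((\<lambda>u. (f (x + u *\<^sub>R h) \<bullet> h - f x \<bullet> h) / u) \<longlongrightarrow> f' h \<bullet> h) (at_right 0)"
    by (rule filterlim_mono) (auto simp: at_le)
  then show ?thesis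
  proof (rule tendsto_lowerbound)
    show "\<forall>\<^sub>F u in at_right 0. 0 \<le> (f (x + u *\<^sub>R h) \<bullet> h - f x \<bullet> h) / u"
      using eventually_at_right_less
    proof eventually_elim
      case (elim u)
      then show ?case
        using mono[of "x + u *\<^sub>R h"] by (simp add: inner_diff_left zero_le_mult_iff)
    qed
  qed simp
qed

section \<open>Gradient maps onto convex hulls\<close>

text \<open>A smooth upper bound for the support function of the convex hull of \<open>V\<close>.
  Its gradient is \<open>softmax V\<close>, a convex combination of the points of \<open>V\<close>
  with positive weights.\<close>

definition logsumexp :: "'a::euclidean_space set \<Rightarrow> 'a \<Rightarrow> real" where
  "logsumexp V x = ln (\<Sum>v\<in>V. exp (v \<bullet> x))"

definition softmax :: "'a::euclidean_space set \<Rightarrow> 'a \<Rightarrow> 'a" where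
  "softmax V x = (\<Sum>v\<in>V. (exp (v \<bullet> x) / (\<Sum>w\<in>V. exp (w \<bullet> x))) *\<^sub>R v)"

lemma sum_exp_inner_pos:
  assumes "finite V" "V \<noteq> {}"
  shows "(\<Sum>v\<in>V. exp (v \<bullet> x)) > 0"
  using assms by (intro sum_pos) auto

lemma has_derivative_logsumexp:
  assumes "finite V" "V \<noteq> {}"
  shows "(logsumexp V has_derivative (\<lambda>h. softmax V x \<bullet> h)) (at x)"
proof -
  have pos: "(\<Sum>v\<in>V. exp (v \<bullet> x)) > 0" by (rule sum_exp_inner_pos[OF assms])
  have "((\<lambda>y. \<Sum>v\<in>V. exp (v \<bullet> y)) has_derivative (\<lambda>h. \<Sum>v\<in>V. (v \<bullet> h) * exp (v \<bullet> x))) (at x)"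
    by (auto intro!: derivative_eq_intros)
  from has_derivative_ln[OF pos this] show ?thesis
    unfolding logsumexp_def[abs_def] softmax_def
    by (rule has_derivative_eq_rhs)
       (simp add: fun_eq_iff inner_sum_left sum_distrib_left sum_distrib_right divide_simps mult_ac)
qed

text \<open>The derivative is kept abstract: the sign of the Jacobian determinant will come from
  monotonicity and not from a formula for the Hessian.\<close>

lemma softmax_differentiable:
  assumes "finite V" "V \<noteq> {}"
  shows "(softmax V has_derivative frechet_derivative (softmax V) (at x)) (at x)"
proof -
  have "(\<Sum>w\<in>V. exp (w \<bullet> x)) \<noteq> 0" using sum_exp_inner_pos[OF assms, of x] by simp
  then have "softmax V differentiable (at x)"
    unfolding softmax_def[abs_def] differentiable_def
    by (fast intro!: derivative_eq_intros refl)
  then show ?thesis by (simp add: frechet_derivative_works)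
qed

lemma softmax_in_convex_hull:
  assumes "finite V" "V \<noteq> {}"
  shows "softmax V x \<in> convex hull V"
  unfolding softmax_def using assms sum_exp_inner_pos[OF assms, of x]
  by (intro convex_sum) (auto intro: hull_inc simp: sum_divide_distrib[symmetric])

text \<open>One exponential is at most the sum of all of them, and a half-space that contains
  \<open>V\<close> contains its hull. This bound makes the potential in
  \<open>range_gradient_comb\<close> coercive.\<close>

lemma inner_le_logsumexp:
  assumes "finite V" "a \<in> convex hull V"
  shows "a \<bullet> x \<le> logsumexp V x"
proof -
  have V: "V \<noteq> {}" using assms(2) by auto
  have "convex {a. a \<bullet> x \<le> logsumexp V x}"
    using convex_halfspace_le[of x "logsumexp V x"] by (simp add: inner_commute)
  moreover have "v \<bullet> x \<le> logsumexp V x" if "v \<in> V" for v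
    unfolding logsumexp_def using that assms(1) sum_exp_inner_pos[OF assms(1) V, of x]
    by (subst ln_ge_iff) (auto intro: member_le_sum)
  ultimately have "convex hull V \<subseteq> {a. a \<bullet> x \<le> logsumexp V x}"
    by (intro hull_minimal) auto
  then show ?thesis using assms(2) by auto
qed

text \<open>With \<open>p\<close> and \<open>q\<close> the softmax weights at \<open>x\<close> and \<open>y\<close>, the inner product is
  \<open>\<Sum>v. (p v - q v) (ln (p v) - ln (q v))\<close>, a sum of nonnegative terms.\<close>

lemma softmax_monotone:
  assumes "finite V" "V \<noteq> {}"
  shows "(softmax V x - softmax V y) \<bullet> (x - y) \<ge> 0"
proof -
  define p where "p z v = exp (v \<bullet> z) / (\<Sum>w\<in>V. exp (w \<bullet> z))" for z v
  have pos: "p z v > 0" for z v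
    unfolding p_def using sum_exp_inner_pos[OF assms, of z] by simp
  have sum1: "(\<Sum>v\<in>V. p z v) = 1" for z
    unfolding p_def using sum_exp_inner_pos[OF assms, of z]
    by (simp add: sum_divide_distrib[symmetric])
  have ln_p: "ln (p z v) = v \<bullet> z - logsumexp V z" for z v
    unfolding p_def logsumexp_def using sum_exp_inner_pos[OF assms, of z]
    by (simp add: ln_div)
  have "(softmax V x - softmax V y) \<bullet> (x - y) = (\<Sum>v\<in>V. (p x v - p y v) * (v \<bullet> (x - y)))"
    unfolding softmax_def p_def[symmetric]
    by (simp add: sum_subtractf[symmetric] scaleR_diff_left[symmetric] inner_sum_left)
  also have "\<dots> = (\<Sum>v\<in>V. (p x v - p y v) * (ln (p x v) - ln (p y v)) +
      (logsumexp V x - logsumexp V y) * (p x v - p y v))"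
    by (intro sum.cong refl) (simp add: ln_p algebra_simps)
  also have "\<dots> = (\<Sum>v\<in>V. (p x v - p y v) * (ln (p x v) - ln (p y v)))"
    by (simp add: sum.distrib sum_distrib_left[symmetric] sum_subtractf sum1)
  also have "\<dots> \<ge> 0"
  proof (rule sum_nonneg)
    fix v assume "v \<in> V"
    show "(p x v - p y v) * (ln (p x v) - ln (p y v)) \<ge> 0"
      using pos[of x v] pos[of y v]
      by (cases "p x v \<ge> p y v") (auto intro: mult_nonneg_nonneg mult_nonpos_nonpos)
  qed
  finally show ?thesis .
qed

section \<open>A strictly monotone gradient map into the unit ball\<close>

text \<open>The gradient of sqrt (1 + |x|^2). A small multiple of it, added to the softmax maps,
  makes the sum injective even if the hulls are lower-dimensional, and corresponds to thickening the
  Minkowski sum by a small ball.\<close>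

definition to_unit_ball :: "'a::euclidean_space \<Rightarrow> 'a" where
  "to_unit_ball x = x /\<^sub>R sqrt (1 + x \<bullet> x)"

lemma one_plus_inner_pos: "1 + x \<bullet> x > 0"
  by (metis add_pos_nonneg inner_ge_zero zero_less_one)

lemma has_derivative_sqrt_one_plus_inner:
  "((\<lambda>x. sqrt (1 + x \<bullet> x)) has_derivative (\<lambda>h. to_unit_ball x \<bullet> h)) (at x)"
proof -
  have "((\<lambda>x. 1 + x \<bullet> x) has_derivative (\<lambda>h. x \<bullet> h + h \<bullet> x)) (at x)"
    by (auto intro!: derivative_eq_intros)
  from has_derivative_real_sqrt[OF one_plus_inner_pos this] show ?thesis
    by (rule has_derivative_eq_rhs) (simp add: fun_eq_iff to_unit_ball_def inner_commute divide_simps)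
qed

lemma to_unit_ball_differentiable:
  "(to_unit_ball has_derivative frechet_derivative to_unit_ball (at x)) (at x)"
proof -
  have "sqrt (1 + x \<bullet> x) \<noteq> 0" using one_plus_inner_pos[of x] by simp
  moreover have "(\<lambda>x. sqrt (1 + x \<bullet> x)) differentiable (at x)"
    using has_derivative_sqrt_one_plus_inner differentiable_def by blast
  ultimately have "to_unit_ball differentiable (at x)"
    unfolding to_unit_ball_def[abs_def]
    by (intro differentiable_scaleR differentiable_inverse differentiable_ident) auto
  then show ?thesis by (simp add: frechet_derivative_works)
qed

lemma norm_to_unit_ball: "norm (to_unit_ball x) < 1"
proof -
  have "norm x < sqrt (1 + x \<bullet> x)"
    by (simp add: norm_eq_sqrt_inner)
  then show ?thesis
    using one_plus_inner_pos[of x] by (simp add: to_unit_ball_def divide_simps)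
qed

text \<open>Cauchy-Schwarz for the vectors (1, x) and (1, y), strict since x and y differ, gives 1 +
  <x, y> < a b, where a and b are their norms. The inner product in question decreases in <x, y> and
  would be exactly 0 at <x, y> = a b - 1.\<close>

lemma to_unit_ball_strict_monotone:
  assumes "x \<noteq> y"
  shows "(to_unit_ball x - to_unit_ball y) \<bullet> (x - y) > 0"
proof -
  define a b where "a = sqrt (1 + x \<bullet> x)" and "b = sqrt (1 + y \<bullet> y)"
  have ab: "a > 0" "b > 0" "a\<^sup>2 = 1 + x \<bullet> x" "b\<^sup>2 = 1 + y \<bullet> y"
    using one_plus_inner_pos[of x] one_plus_inner_pos[of y] by (auto simp: a_def b_def)
  have "(1 + x \<bullet> y)\<^sup>2 < (a * b)\<^sup>2"
  proof -
    have "(a * b)\<^sup>2 - (1 + x \<bullet> y)\<^sup>2 = (x - y) \<bullet> (x - y) + ((x \<bullet> x) * (y \<bullet> y) - (x \<bullet> y)\<^sup>2)"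
      unfolding power_mult_distrib ab
      by (simp add: power2_eq_square algebra_simps inner_commute)
    moreover have "(x - y) \<bullet> (x - y) > 0" using assms by simp
    moreover have "(x \<bullet> y)\<^sup>2 \<le> (x \<bullet> x) * (y \<bullet> y)" by (rule Cauchy_Schwarz_ineq)
    ultimately show ?thesis by linarith
  qed
  then have xy: "x \<bullet> y < a * b - 1"
    using power2_less_imp_less[of "1 + x \<bullet> y" "a * b"] ab by simp
  have "(to_unit_ball x - to_unit_ball y) \<bullet> (x - y) =
      (x \<bullet> x) / a + (y \<bullet> y) / b - (x \<bullet> y) * (1 / a + 1 / b)"
    by (simp add: to_unit_ball_def a_def[symmetric] b_def[symmetric] inner_diff_left inner_diff_right
        inner_commute divide_simps algebra_simps)
  also have "\<dots> > (x \<bullet> x) / a + (y \<bullet> y) / b - (a * b - 1) * (1 / a + 1 / b)"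
    using xy ab by (intro diff_strict_left_mono mult_strict_right_mono add_pos_pos) auto
  also have "(x \<bullet> x) / a + (y \<bullet> y) / b - (a * b - 1) * (1 / a + 1 / b) = 0"
  proof -
    have xx: "x \<bullet> x = a\<^sup>2 - 1" and yy: "y \<bullet> y = b\<^sup>2 - 1" using ab by auto
    show ?thesis unfolding xx yy using ab(1,2) by (simp add: power2_eq_square field_simps)
  qed
  finally show ?thesis .
qed

section \<open>Thickened Minkowski combinations as ranges of gradient maps\<close>

text \<open>The left-hand form matches the values of the gradient map; the union of balls shows
  openness and is convenient for comparing the set with neighbourhoods.\<close>

lemma thickened_comb_eq_UN_ball:
  fixes A B :: "'a::euclidean_space set"
  assumes "e > 0"
  shows "{s *\<^sub>R a + t *\<^sub>R b + e *\<^sub>R c |a b c. a \<in> A \<and> b \<in> B \<and> c \<in> ball 0 1} =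
    (\<Union>a\<in>A. \<Union>b\<in>B. ball (s *\<^sub>R a + t *\<^sub>R b) e)" (is "?L = ?R")
proof
  have "dist p (p + e *\<^sub>R c) < e" if "c \<in> ball 0 1" for p c :: 'a
    using that assms by (simp add: dist_norm)
  then show "?L \<subseteq> ?R"
    by fastforce
  show "?R \<subseteq> ?L"
  proof
    fix x assume "x \<in> ?R"
    then obtain a b where ab: "a \<in> A" "b \<in> B" "norm (s *\<^sub>R a + t *\<^sub>R b - x) < e"
      by (auto simp: dist_norm)
    define c where "c = (x - (s *\<^sub>R a + t *\<^sub>R b)) /\<^sub>R e"
    have "norm c < 1"
      using ab(3) assms by (simp add: c_def norm_minus_commute divide_simps)
    moreover have "x = s *\<^sub>R a + t *\<^sub>R b + e *\<^sub>R c"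
      using assms by (simp add: c_def)
    ultimately show "x \<in> ?L"
      using ab by (auto simp: dist_norm)
  qed
qed

lemma lmeasurable_thickened_comb:
  fixes A B :: "'a::euclidean_space set"
  assumes "bounded A" "bounded B" "e > 0"
  shows "{s *\<^sub>R a + t *\<^sub>R b + e *\<^sub>R c |a b c. a \<in> A \<and> b \<in> B \<and> c \<in> ball 0 1} \<in> lmeasurable"
proof (rule lmeasurable_open)
  show "open {s *\<^sub>R a + t *\<^sub>R b + e *\<^sub>R c |a b c. a \<in> A \<and> b \<in> B \<and> c \<in> ball 0 1}"
    unfolding thickened_comb_eq_UN_ball[OF assms(3)] by auto
  obtain p q where p: "\<And>a. a \<in> A \<Longrightarrow> norm a \<le> p" and q: "\<And>b. b \<in> B \<Longrightarrow> norm b \<le> q"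
    using assms(1,2) by (meson bounded_iff)
  show "bounded {s *\<^sub>R a + t *\<^sub>R b + e *\<^sub>R c |a b c. a \<in> A \<and> b \<in> B \<and> c \<in> ball 0 1}"
    unfolding bounded_iff
  proof (intro exI ballI)
    fix x assume "x \<in> {s *\<^sub>R a + t *\<^sub>R b + e *\<^sub>R c |a b c. a \<in> A \<and> b \<in> B \<and> c \<in> ball 0 1}"
    then obtain a b c where x: "x = s *\<^sub>R a + t *\<^sub>R b + e *\<^sub>R c" "a \<in> A" "b \<in> B" "norm c < 1"
      by (auto simp: dist_norm)
    have "norm x \<le> norm (s *\<^sub>R a) + norm (t *\<^sub>R b) + norm (e *\<^sub>R c)"
      unfolding x(1) by (intro norm_triangle_le add_right_mono norm_triangle_ineq)
    also have "\<dots> \<le> \<bar>s\<bar> * p + \<bar>t\<bar> * q + \<bar>e\<bar> * 1"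
      unfolding norm_scaleR using x p q
      by (intro add_mono mult_left_mono) auto
    finally show "norm x \<le> \<bar>s\<bar> * p + \<bar>t\<bar> * q + \<bar>e\<bar> * 1" .
  qed
qed

text \<open>A point \<open>y\<close> is a value of the map exactly where the potential minus the
  linear form <y, .> has a critical point. For \<open>y\<close> in the thickened set this difference
  is coercive, so it has a minimum, and there the gradient vanishes.\<close>

lemma range_gradient_comb:
  fixes V W :: "'a::euclidean_space set"
  assumes V: "finite V" "V \<noteq> {}" and W: "finite W" "W \<noteq> {}"
    and st: "s \<ge> 0" "t \<ge> 0" and e: "e > 0"
  shows "range (\<lambda>x. s *\<^sub>R softmax V x + t *\<^sub>R softmax W x + e *\<^sub>R to_unit_ball x) =
    {s *\<^sub>R a + t *\<^sub>R b + e *\<^sub>R c |a b c. a \<in> convex hull V \<and> b \<in> convex hull W \<and> c \<in> ball 0 1}"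
    (is "range ?G = ?E")
proof
  show "range ?G \<subseteq> ?E"
    using softmax_in_convex_hull[OF V] softmax_in_convex_hull[OF W] norm_to_unit_ball
    by (auto simp: dist_norm intro!: exI)
  show "?E \<subseteq> range ?G"
  proof
    fix y assume "y \<in> ?E"
    then obtain a b c where y: "y = s *\<^sub>R a + t *\<^sub>R b + e *\<^sub>R c" "a \<in> convex hull V" "b \<in> convex hull W"
      and c: "norm c < 1"
      by (auto simp: dist_norm)
    define \<Phi> where "\<Phi> x = s * logsumexp V x + t * logsumexp W x + e * sqrt (1 + x \<bullet> x) - y \<bullet> x" for x
    have deriv: "(\<Phi> has_derivative (\<lambda>h. (?G x - y) \<bullet> h)) (at x)" for x
      unfolding \<Phi>_def[abs_def]
      using has_derivative_diff[OF has_derivative_add[OF has_derivative_add[OF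
          has_derivative_mult_right[OF has_derivative_logsumexp[OF V], of s]
          has_derivative_mult_right[OF has_derivative_logsumexp[OF W], of t]]
          has_derivative_mult_right[OF has_derivative_sqrt_one_plus_inner, of e]]
          has_derivative_inner_right[OF has_derivative_ident, of y], of x]
      by (simp add: inner_diff_left inner_add_left)
    \<comment> \<open>The hull points \<open>a\<close> and \<open>b\<close> are absorbed by the two
      \<open>logsumexp\<close> terms. The ball point \<open>c\<close> leaves linear growth with
      positive slope because its norm is strictly below 1.\<close>
    have lower: "\<Phi> x \<ge> e * (1 - norm c) * norm x" for x
    proof -
      have "s * (a \<bullet> x) \<le> s * logsumexp V x" "t * (b \<bullet> x) \<le> t * logsumexp W x"
        using inner_le_logsumexp V W y st by (auto intro: mult_left_mono)
      moreover have "e * (c \<bullet> x) \<le> e * (norm c * norm x)"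
        using e norm_cauchy_schwarz by (intro mult_left_mono) auto
      moreover have "e * norm x \<le> e * sqrt (1 + x \<bullet> x)"
        using e by (intro mult_left_mono) (auto simp: norm_eq_sqrt_inner)
      ultimately show ?thesis
        unfolding \<Phi>_def y(1) by (simp add: inner_add_left algebra_simps)
    qed
    \<comment> \<open>Outside the ball of this radius the lower bound exceeds the value at 0, so a
      minimum over the ball is a global one.\<close>
    define R where "R = \<Phi> 0 / (e * (1 - norm c))"
    have k: "e * (1 - norm c) > 0" using e c by simp
    have "\<Phi> 0 \<ge> 0" using lower[of 0] by simp
    then have "R \<ge> 0" using k by (simp add: R_def)
    have "continuous_on (cball 0 R) \<Phi>"
      using deriv by (intro has_derivative_continuous_on) (auto intro: has_derivative_at_withinI)
    then obtain x where x: "x \<in> cball 0 R" "\<And>z. z \<in> cball 0 R \<Longrightarrow> \<Phi> x \<le> \<Phi> z"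
      using continuous_attains_inf[of "cball 0 R" \<Phi>] \<open>R \<ge> 0\<close> by auto
    have "\<Phi> x \<le> \<Phi> z" for z
    proof (cases "z \<in> cball 0 R")
      case False
      then have "norm z > R" by (simp add: dist_norm)
      then have "\<Phi> 0 < e * (1 - norm c) * norm z"
        using k by (simp add: R_def divide_less_eq mult.commute)
      with lower[of z] x(2)[of 0] \<open>R \<ge> 0\<close> show ?thesis by auto
    qed (use x in auto)
    then have "(\<lambda>h. (?G x - y) \<bullet> h) = (\<lambda>h. 0)"
      by (intro differential_zero_maxmin[OF _ _ deriv, of _ UNIV]) auto
    then have "(?G x - y) \<bullet> (?G x - y) = 0" by meson
    then show "y \<in> range ?G" by (auto simp: image_iff intro!: exI[of _ x])
  qed
qed

text \<open>By the change of variables formula the volume is the integral of the absolute Jacobian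
  determinant of an injective map. Monotonicity removes the absolute value, and what remains is, at
  each point of the domain, a polynomial in \<open>s\<close> of degree at most
  \<open>CARD('m)\<close>.\<close>

lemma poly_on_nonneg_measure_thickened:
  fixes V W :: "(real ^ 'm::{finite,wellorder}) set"
  assumes V: "finite V" "V \<noteq> {}" and W: "finite W" "W \<noteq> {}"
    and t: "t \<ge> 0" and e: "e > 0"
  shows "poly_on_nonneg CARD('m) (\<lambda>s. measure lebesgue
    {s *\<^sub>R a + t *\<^sub>R b + e *\<^sub>R c |a b c. a \<in> convex hull V \<and> b \<in> convex hull W \<and> c \<in> ball 0 1})"
    (is "poly_on_nonneg _ (\<lambda>s. measure lebesgue (?E s))")
proof -
  define V' where "V' x = frechet_derivative (softmax V) (at x)" for x
  define W' where "W' x = frechet_derivative (softmax W) (at x)" for x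
  define U' where "U' x = frechet_derivative to_unit_ball (at x)" for x :: "(real, 'm) vec"
  define G where "G s x = s *\<^sub>R softmax V x + t *\<^sub>R softmax W x + e *\<^sub>R to_unit_ball x" for s x
  \<comment> \<open>The summands without \<open>s\<close> are grouped together, so that the matrix
    of the derivative has the shape required by \<open>poly_on_nonneg_det\<close>.\<close>
  define G' where "G' s x h = s *\<^sub>R V' x h + (t *\<^sub>R W' x h + e *\<^sub>R U' x h)" for s x h
  have deriv: "(G s has_derivative G' s x) (at x)" for s x
    unfolding G_def[abs_def] G'_def[abs_def] V'_def W'_def U'_def
    by (auto intro!: derivative_eq_intros softmax_differentiable V W to_unit_ball_differentiable)
  have mono: "(G s x - G s y) \<bullet> (x - y) > 0" if "s \<ge> 0" "x \<noteq> y" for s x y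
  proof -
    have "(G s x - G s y) \<bullet> (x - y) = s * ((softmax V x - softmax V y) \<bullet> (x - y)) +
      t * ((softmax W x - softmax W y) \<bullet> (x - y)) + e * ((to_unit_ball x - to_unit_ball y) \<bullet> (x - y))"
      by (simp add: G_def algebra_simps inner_diff_left inner_diff_right inner_add_left inner_add_right)
    \<comment> \<open>Strictness comes from the ball term: \<open>s\<close> and \<open>t\<close> may
      be 0, and \<open>softmax\<close> of a singleton is constant.\<close>
    also have "\<dots> > 0"
      using that t e softmax_monotone[OF V] softmax_monotone[OF W]
      by (intro add_nonneg_pos add_nonneg_nonneg mult_nonneg_nonneg mult_pos_pos
          to_unit_ball_strict_monotone) auto
    finally show ?thesis .
  qed
  have det_nonneg: "det (matrix (G' s x)) \<ge> 0" if "s \<ge> 0" for s x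
  proof (rule det_nonneg_of_monotone)
    show "linear (G' s x)" using deriv has_derivative_linear by blast
    show "G' s x h \<bullet> h \<ge> 0" for h
    proof (rule derivative_of_monotone[OF deriv])
      show "(G s y - G s x) \<bullet> (y - x) \<ge> 0" for y
        using mono[OF that, of y x] by (cases "y = x") auto
    qed
  qed
  have integral: "((\<lambda>x. det (matrix (G' s x))) has_integral measure lebesgue (?E s)) UNIV"
    if s: "s \<ge> 0" for s
  proof -
    have "inj (G s)"
      by (rule injI, rule ccontr) (use mono[OF s] in fastforce)
    moreover have "range (G s) = ?E s"
      unfolding G_def by (rule range_gradient_comb[OF V W s t e])
    moreover have "?E s \<in> lmeasurable"
      by (intro lmeasurable_thickened_comb e) (auto simp: V W finite_imp_bounded bounded_convex_hull)
    ultimately have "((\<lambda>x. \<bar>det (matrix (G' s x))\<bar>) has_integral measure lebesgue (?E s)) UNIV"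
      using has_measure_differentiable_image[of UNIV "G s" "G' s" "measure lebesgue (?E s)"] deriv
      by auto
    then show ?thesis using det_nonneg[OF s] by simp
  qed
  have matrix: "matrix (G' s x) = s *\<^sub>R matrix (V' x) + matrix (\<lambda>h. t *\<^sub>R W' x h + e *\<^sub>R U' x h)" for s x
    by (simp add: matrix_def G'_def vec_eq_iff)
  show ?thesis
    by (rule poly_on_nonneg_has_integral[OF _ integral]) (simp_all add: matrix poly_on_nonneg_det)
qed

section \<open>Minkowski's theorem for two bodies\<close>

text \<open>The library's change of variables theorem requires a well-ordered index type, which the types of the
  target theorem do not provide.\<close>

typedef (overloaded) ('a::euclidean_space) basis_index = "Basis :: 'a set"
  morphisms basis_of Abs_basis_index
  using nonempty_Basis by blast

lemma bij_betw_basis_of: "bij_betw basis_of (UNIV :: 'a::euclidean_space basis_index set) Basis"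
  by (simp add: bij_betw_def inj_on_def basis_of_inject
      type_definition.Rep_range[OF type_definition_basis_index])

instance basis_index :: (euclidean_space) finite
  by standard (simp add: bij_betw_finite[OF bij_betw_basis_of])

lemma card_basis_index [simp]: "CARD('a::euclidean_space basis_index) = DIM('a)"
  using bij_betw_same_card[OF bij_betw_basis_of] .

instantiation basis_index :: (euclidean_space) wellorder
begin

definition less_eq_basis_index :: "'a basis_index \<Rightarrow> 'a basis_index \<Rightarrow> bool" where
  "i \<le> j \<longleftrightarrow> to_nat_on Basis (basis_of i) \<le> to_nat_on Basis (basis_of j)"

definition less_basis_index :: "'a basis_index \<Rightarrow> 'a basis_index \<Rightarrow> bool" where
  "i < j \<longleftrightarrow> to_nat_on Basis (basis_of i) < to_nat_on Basis (basis_of j)"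

instance
proof
  fix P :: "'a basis_index \<Rightarrow> bool" and i
  assume step: "\<And>x. (\<And>y. y < x \<Longrightarrow> P y) \<Longrightarrow> P x"
  show "P i"
  proof (induction "to_nat_on Basis (basis_of i)" arbitrary: i rule: less_induct)
    case less
    show ?case
      by (rule step, rule less) (simp add: less_basis_index_def)
  qed
next
  fix i j :: "'a basis_index"
  assume "i \<le> j" "j \<le> i"
  then have "to_nat_on Basis (basis_of i) = to_nat_on Basis (basis_of j)"
    by (simp add: less_eq_basis_index_def)
  then show "i = j"
    using to_nat_on_inj[OF countable_finite[OF finite_Basis] basis_of basis_of, of i j]
    by (simp add: basis_of_inject)
qed (auto simp: less_eq_basis_index_def less_basis_index_def)

end

text \<open>A linear isometry onto the given space from coordinate vectors over a well-ordered index
  type. It also preserves Lebesgue measure, so volumes can be computed in coordinates.\<close>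

definition of_coords :: "real ^ 'a basis_index \<Rightarrow> 'a::euclidean_space" where
  "of_coords x = (\<Sum>i\<in>UNIV. x $ i *\<^sub>R basis_of i)"

lemma linear_of_coords: "linear of_coords"
  by (auto simp: of_coords_def linear_iff sum.distrib scaleR_add_left scaleR_sum_right)

lemma of_coords_inner_Basis: "of_coords x \<bullet> basis_of i = x $ i"
proof -
  have "of_coords x \<bullet> basis_of i = (\<Sum>j\<in>UNIV. if i = j then x $ j else 0)"
    unfolding of_coords_def inner_sum_left
    by (intro sum.cong refl) (auto simp: inner_Basis basis_of basis_of_inject)
  then show ?thesis by simp
qed

lemma inner_of_coords: "of_coords x \<bullet> of_coords y = x \<bullet> y"
proof -
  have "of_coords x \<bullet> of_coords y = (\<Sum>i\<in>UNIV. of_coords x \<bullet> (y $ i *\<^sub>R basis_of i))"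
    unfolding of_coords_def[of y] by (rule inner_sum_right)
  then show ?thesis
    by (simp add: of_coords_inner_Basis inner_vec_def mult.commute)
qed

lemma bij_of_coords: "bij (of_coords :: real ^ 'a basis_index \<Rightarrow> 'a::euclidean_space)"
proof (rule bijI)
  show "inj (of_coords :: real ^ 'a basis_index \<Rightarrow> 'a)"
  proof (rule injI)
    fix x y :: "real ^ 'a basis_index"
    assume "of_coords x = of_coords y"
    then have "of_coords x \<bullet> basis_of i = of_coords y \<bullet> basis_of i" for i by simp
    then show "x = y" by (simp add: of_coords_inner_Basis vec_eq_iff)
  qed
  show "surj (of_coords :: real ^ 'a basis_index \<Rightarrow> 'a)"
  proof (rule surjI)
    fix y :: 'a
    have "of_coords (\<chi> i. y \<bullet> basis_of i) = (\<Sum>i\<in>UNIV. (y \<bullet> basis_of i) *\<^sub>R basis_of i)"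
      by (simp add: of_coords_def)
    also have "\<dots> = (\<Sum>b\<in>Basis. (y \<bullet> b) *\<^sub>R b)"
      by (rule sum.reindex_bij_betw[OF bij_betw_basis_of])
    finally show "of_coords (\<chi> i. y \<bullet> basis_of i) = y"
      by (simp only: euclidean_representation)
  qed
qed

lemma borel_measurable_of_coords [measurable]:
  "(of_coords :: _ \<Rightarrow> 'a::euclidean_space) \<in> borel_measurable borel"
  by (intro borel_measurable_continuous_onI linear_continuous_on)
     (simp add: linear_of_coords linear_conv_bounded_linear[symmetric])

text \<open>Lebesgue measure is determined by its values on boxes, and boxes pull back to boxes with
  the same side lengths.\<close>

lemma distr_of_coords: "distr lborel borel of_coords = (lborel :: 'a::euclidean_space measure)"
proof (rule lborel_eqI[symmetric])
  fix l u :: 'a assume le: "\<And>b. b \<in> Basis \<Longrightarrow> l \<bullet> b \<le> u \<bullet> b"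
  obtain l' where l': "l = of_coords l'"
    by (rule surjE[OF bij_is_surj[OF bij_of_coords]])
  obtain u' where u': "u = of_coords u'"
    by (rule surjE[OF bij_is_surj[OF bij_of_coords]])
  have box: "of_coords -` box l u = box l' u'"
  proof -
    have "(\<forall>b\<in>Basis. P b) \<longleftrightarrow> (\<forall>i. P (basis_of i))" for P :: "'a \<Rightarrow> bool"
      by (subst bij_betw_imp_surj_on[OF bij_betw_basis_of, symmetric]) simp
    then show ?thesis
      by (auto simp: box_def l' u' of_coords_inner_Basis mem_box_cart Basis_vec_def inner_axis)
  qed
  have le': "l' $ i \<le> u' $ i" for i
    using le[OF basis_of, of i] by (simp add: l' u' of_coords_inner_Basis)
  have "emeasure (distr lborel borel of_coords) (box l u) = emeasure lborel (box l' u')"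
    by (simp add: emeasure_distr box)
  also have "\<dots> = (\<Prod>b\<in>Basis. (u' - l') \<bullet> b)"
    using le' by (intro emeasure_lborel_box) (auto simp: Basis_vec_def inner_axis)
  also have "\<dots> = (\<Prod>i\<in>UNIV. (u' - l') $ i)"
    by (simp add: Basis_vec_def UNION_singleton_eq_range prod.reindex inj_on_def axis_eq_axis inner_axis)
  also have "\<dots> = (\<Prod>i\<in>UNIV. (u - l) \<bullet> basis_of i)"
    by (simp add: l' u' inner_diff_left of_coords_inner_Basis)
  also have "\<dots> = (\<Prod>b\<in>Basis. (u - l) \<bullet> b)"
    by (rule arg_cong[where f=ennreal], rule prod.reindex_bij_betw[OF bij_betw_basis_of])
  finally show "emeasure (distr lborel borel of_coords) (box l u) = (\<Prod>b\<in>Basis. (u - l) \<bullet> b)" .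
qed simp

section \<open>Minkowski combinations as limits of thickened polytopes\<close>

definition minkowski_comb :: "real \<Rightarrow> 'a::real_vector set \<Rightarrow> real \<Rightarrow> 'a set \<Rightarrow> 'a set" where
  "minkowski_comb s A t B = {s *\<^sub>R a + t *\<^sub>R b |a b. a \<in> A \<and> b \<in> B}"

lemma minkowski_comb_commute: "minkowski_comb s A t B = minkowski_comb t B s A"
  by (auto simp: minkowski_comb_def) (use add.commute in blast)+

lemma compact_minkowski_comb:
  fixes A B :: "'a::euclidean_space set"
  assumes "compact A" "compact B"
  shows "compact (minkowski_comb s A t B)"
proof -
  have "minkowski_comb s A t B = (\<lambda>x. s *\<^sub>R fst x + t *\<^sub>R snd x) ` (A \<times> B)"
    by (force simp: minkowski_comb_def)
  moreover have "continuous_on (A \<times> B) (\<lambda>x. s *\<^sub>R fst x + t *\<^sub>R snd x)"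
    by (intro continuous_intros)
  ultimately show ?thesis
    using assms by (simp add: compact_continuous_image compact_Times)
qed

text \<open>The closed neighbourhoods decrease to \<open>C\<close>, so continuity of measure from
  above applies. They serve as the outer sets of a sandwich argument.\<close>

lemma measure_infdist_neighbourhood_LIMSEQ:
  fixes C :: "'a::euclidean_space set"
  assumes "compact C" "C \<noteq> {}" "decseq e" "e \<longlonglongrightarrow> 0" "\<And>k. e k > 0"
  shows "(\<lambda>k. measure lebesgue {x. infdist x C \<le> e k}) \<longlonglongrightarrow> measure lebesgue C"
    and "{x. infdist x C \<le> e k} \<in> lmeasurable"
proof -
  have compact: "compact {x. infdist x C \<le> e k}" for k
    using assms by (intro compact_infdist_le) auto
  then show "{x. infdist x C \<le> e k} \<in> lmeasurable" for k by (rule lmeasurable_compact)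
  have eq: "(\<Inter>k. {x. infdist x C \<le> e k}) = C"
  proof (intro equalityI subsetI)
    fix x assume "x \<in> (\<Inter>k. {x. infdist x C \<le> e k})"
    then have "infdist x C \<le> 0"
      using LIMSEQ_le_const[OF assms(4)] by auto
    then show "x \<in> C"
      using assms(1,2) by (metis compact_imp_closed in_closed_iff_infdist_zero infdist_nonneg order_antisym)
  qed (use assms in \<open>auto intro: less_imp_le\<close>)
  have "(\<lambda>k. measure lebesgue {x. infdist x C \<le> e k}) \<longlonglongrightarrow> measure lebesgue (\<Inter>k. {x. infdist x C \<le> e k})"
  proof (rule Lim_measure_decseq)
    show "range (\<lambda>k. {x. infdist x C \<le> e k}) \<subseteq> sets lebesgue"
      using compact lmeasurable_compact by (auto intro: fmeasurableD)
    show "decseq (\<lambda>k. {x. infdist x C \<le> e k})"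
      using assms(3) unfolding decseq_def by (auto intro: order_trans)
    show "emeasure lebesgue {x. infdist x C \<le> e k} \<noteq> \<infinity>" for k
      using fmeasurableD2[OF lmeasurable_compact[OF compact]] by simp
  qed
  then show "(\<lambda>k. measure lebesgue {x. infdist x C \<le> e k}) \<longlonglongrightarrow> measure lebesgue C"
    by (simp only: eq)
qed

lemma poly_on_nonneg_measure_comb_cart:
  fixes A B :: "(real ^ 'm::{finite,wellorder}) set"
  assumes A: "convex_body A" and B: "convex_body B" and t: "t \<ge> 0"
  shows "poly_on_nonneg CARD('m) (\<lambda>s. measure lebesgue (minkowski_comb s A t B))"
proof -
  define e where "e k = inverse (real (Suc k))" for k
  have e: "e k > 0" for k by (simp add: e_def)
  have e_lim: "e \<longlonglongrightarrow> 0" unfolding e_def[abs_def] by (rule LIMSEQ_inverse_real_of_nat)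
  have e_dec: "decseq e" unfolding e_def[abs_def] decseq_def by simp
  have AB: "compact A" "convex A" "A \<noteq> {}" "compact B" "convex B" "B \<noteq> {}"
    using A B by (auto simp: convex_body_def)
  \<comment> \<open>The mesh is the square of the thickening radius \<open>e k\<close>: the net
    error is then at most (s + t) (e k)^2, which is below \<open>e k\<close> for large
    \<open>k\<close>.\<close>
  have "\<exists>V. finite V \<and> V \<subseteq> A \<and> A \<subseteq> (\<Union>v\<in>V. ball v (e k ^ 2))" for k
    using seq_compact_imp_totally_bounded[OF compact_imp_seq_compact[OF AB(1)], rule_format, of "e k ^ 2"] e[of k]
    by simp
  then obtain V where V: "\<And>k. finite (V k)" "\<And>k. V k \<subseteq> A" "\<And>k. A \<subseteq> (\<Union>v\<in>V k. ball v (e k ^ 2))"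
    by metis
  have "\<exists>V. finite V \<and> V \<subseteq> B \<and> B \<subseteq> (\<Union>v\<in>V. ball v (e k ^ 2))" for k
    using seq_compact_imp_totally_bounded[OF compact_imp_seq_compact[OF AB(4)], rule_format, of "e k ^ 2"] e[of k]
    by simp
  then obtain W where W: "\<And>k. finite (W k)" "\<And>k. W k \<subseteq> B" "\<And>k. B \<subseteq> (\<Union>v\<in>W k. ball v (e k ^ 2))"
    by metis
  have ne: "V k \<noteq> {}" "W k \<noteq> {}" for k using V(3)[of k] W(3)[of k] AB by auto
  define E where "E k s = {s *\<^sub>R a + t *\<^sub>R b + e k *\<^sub>R c |a b c.
    a \<in> convex hull V k \<and> b \<in> convex hull W k \<and> c \<in> ball 0 1}" for k s
  show ?thesis
  proof (rule poly_on_nonneg_LIMSEQ)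
    show "poly_on_nonneg CARD('m) (\<lambda>s. measure lebesgue (E k s))" for k
      unfolding E_def by (intro poly_on_nonneg_measure_thickened V W ne t e)
    fix s :: real assume s: "s \<ge> 0"
    let ?C = "minkowski_comb s A t B"
    have C: "compact ?C" "?C \<noteq> {}"
      using compact_minkowski_comb AB by (auto simp: minkowski_comb_def)
    have E_meas: "E k s \<in> lmeasurable" for k
      unfolding E_def by (intro lmeasurable_thickened_comb e) (auto simp: V W finite_imp_bounded bounded_convex_hull)
    note D = measure_infdist_neighbourhood_LIMSEQ[OF C e_dec e_lim e]
    show "(\<lambda>k. measure lebesgue (E k s)) \<longlonglongrightarrow> measure lebesgue ?C"
    proof (rule tendsto_sandwich[OF _ _ tendsto_const D(1)])
      \<comment> \<open>How large \<open>k\<close> must be depends on \<open>s\<close>, which is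
        harmless because \<open>poly_on_nonneg_LIMSEQ\<close> asks for pointwise
        convergence.\<close>
      have "\<forall>\<^sub>F k in sequentially. (s + t) * e k < 1"
        using order_tendstoD(2)[OF tendsto_mult_right_zero[OF e_lim], of 1 "s + t"] by simp
      then show "\<forall>\<^sub>F k in sequentially. measure lebesgue ?C \<le> measure lebesgue (E k s)"
      proof eventually_elim
        case (elim k)
        have "?C \<subseteq> E k s"
        proof
          fix x assume "x \<in> ?C"
          then obtain a b where x: "x = s *\<^sub>R a + t *\<^sub>R b" "a \<in> A" "b \<in> B"
            by (auto simp: minkowski_comb_def)
          obtain v where v: "v \<in> V k" "norm (v - a) < e k ^ 2"
            using V(3)[of k] x(2) by (auto simp: dist_norm)
          obtain w where w: "w \<in> W k" "norm (w - b) < e k ^ 2"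
            using W(3)[of k] x(3) by (auto simp: dist_norm)
          have "norm (s *\<^sub>R v + t *\<^sub>R w - x) = norm (s *\<^sub>R (v - a) + t *\<^sub>R (w - b))"
            by (simp add: x algebra_simps)
          also have "\<dots> \<le> s * norm (v - a) + t * norm (w - b)"
            using s t by (intro norm_triangle_le) simp
          also have "\<dots> \<le> s * e k ^ 2 + t * e k ^ 2"
            using v w s t by (intro add_mono mult_left_mono) auto
          also have "\<dots> = ((s + t) * e k) * e k" by (simp add: power2_eq_square algebra_simps)
          also have "\<dots> < 1 * e k" using elim e by (intro mult_strict_right_mono)
          finally have "x \<in> ball (s *\<^sub>R v + t *\<^sub>R w) (e k)" by (simp add: dist_norm)
          then show "x \<in> E k s"
            unfolding E_def thickened_comb_eq_UN_ball[OF e]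
            by (rule UN_I[OF hull_inc[OF v(1)] UN_I[OF hull_inc[OF w(1)]]])
        qed
        then show ?case
          using C(1) E_meas by (intro measure_mono_fmeasurable) (auto intro: fmeasurableD lmeasurable_compact)
      qed
      have "E k s \<subseteq> {x. infdist x ?C \<le> e k}" for k
      proof
        fix x assume "x \<in> E k s"
        then obtain a b where ab: "a \<in> convex hull V k" "b \<in> convex hull W k"
          and x: "x \<in> ball (s *\<^sub>R a + t *\<^sub>R b) (e k)"
          unfolding E_def thickened_comb_eq_UN_ball[OF e] by auto
        have "convex hull V k \<subseteq> A" "convex hull W k \<subseteq> B"
          using V(2) W(2) AB by (simp_all add: hull_minimal)
        then have "s *\<^sub>R a + t *\<^sub>R b \<in> ?C" using ab by (auto simp: minkowski_comb_def)
        from infdist_le[OF this, of x] x show "x \<in> {x. infdist x ?C \<le> e k}"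
          by (simp add: dist_commute)
      qed
      then show "\<forall>\<^sub>F k in sequentially. measure lebesgue (E k s) \<le> measure lebesgue {x. infdist x ?C \<le> e k}"
        using E_meas D(2) by (intro always_eventually allI measure_mono_fmeasurable) (auto intro: fmeasurableD)
    qed
  qed
qed

section \<open>Transfer to arbitrary Euclidean spaces\<close>

lemma measure_of_coords_vimage:
  fixes X :: "'a::euclidean_space set"
  assumes "X \<in> sets borel"
  shows "measure lebesgue (of_coords -` X) = measure lebesgue X"
proof -
  have "of_coords -` X \<in> sets borel" using measurable_sets[OF borel_measurable_of_coords assms] by simp
  then have "measure lebesgue (of_coords -` X) = measure lborel (of_coords -` X)"
    by simp
  also have "\<dots> = measure (distr lborel borel of_coords) X"
    using assms by (simp add: measure_distr)
  also have "\<dots> = measure lebesgue X" using assms by (simp add: distr_of_coords)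
  finally show ?thesis .
qed

lemma convex_body_of_coords_vimage:
  fixes A :: "'a::euclidean_space set"
  assumes "convex_body A"
  shows "convex_body (of_coords -` A)"
proof -
  have A: "compact A" "convex A" "A \<noteq> {}" using assms by (auto simp: convex_body_def)
  have norm: "norm (of_coords x :: 'a) = norm x" for x
    by (simp add: norm_eq_sqrt_inner inner_of_coords)
  obtain M where "\<And>x. x \<in> A \<Longrightarrow> norm x \<le> M"
    using compact_imp_bounded[OF A(1)] by (auto simp: bounded_iff)
  then have "bounded (of_coords -` A)"
    unfolding bounded_iff by (intro exI[of _ M]) (simp add: norm[symmetric])
  moreover have "closed (of_coords -` A)"
    using A(1) compact_imp_closed
    by (intro continuous_closed_vimage linear_continuous_at)
       (auto simp: linear_of_coords linear_conv_bounded_linear[symmetric])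
  moreover have "of_coords -` A \<noteq> {}"
    using A(3) surj_vimage_empty[OF bij_is_surj[OF bij_of_coords], of A] by simp
  ultimately show ?thesis
    using A(2) by (auto simp: convex_body_def compact_eq_bounded_closed linear_of_coords intro: convex_linear_vimage)
qed

lemma of_coords_vimage_minkowski_comb:
  fixes A B :: "'a::euclidean_space set"
  shows "of_coords -` minkowski_comb s A t B = minkowski_comb s (of_coords -` A) t (of_coords -` B)"
proof (intro equalityI subsetI)
  fix x :: "real ^ 'a basis_index" assume "x \<in> of_coords -` minkowski_comb s A t B"
  then obtain a b where ab: "of_coords x = s *\<^sub>R a + t *\<^sub>R b" "a \<in> A" "b \<in> B"
    by (auto simp: minkowski_comb_def)
  obtain a' where a': "a = of_coords a'" by (rule surjE[OF bij_is_surj[OF bij_of_coords]])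
  obtain b' where b': "b = of_coords b'" by (rule surjE[OF bij_is_surj[OF bij_of_coords]])
  have "of_coords x = of_coords (s *\<^sub>R a' + t *\<^sub>R b')"
    using ab(1) by (simp add: a' b' linear_add[OF linear_of_coords] linear_scale[OF linear_of_coords])
  then have "x = s *\<^sub>R a' + t *\<^sub>R b'" by (rule injD[OF bij_is_inj[OF bij_of_coords]])
  then show "x \<in> minkowski_comb s (of_coords -` A) t (of_coords -` B)"
    using ab a' b' by (auto simp: minkowski_comb_def)
next
  fix x :: "real ^ 'a basis_index" assume "x \<in> minkowski_comb s (of_coords -` A) t (of_coords -` B)"
  then show "x \<in> of_coords -` minkowski_comb s A t B"
    by (force simp: minkowski_comb_def linear_add[OF linear_of_coords] linear_scale[OF linear_of_coords])
qed

lemma poly_on_nonneg_measure_comb: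
  fixes A B :: "'a::euclidean_space set"
  assumes A: "convex_body A" and B: "convex_body B" and t: "t \<ge> 0"
  shows "poly_on_nonneg DIM('a) (\<lambda>s. measure lebesgue (minkowski_comb s A t B))"
proof -
  have "minkowski_comb s A t B \<in> sets borel" for s
    using A B by (auto simp: convex_body_def intro: borel_compact compact_minkowski_comb)
  then have "measure lebesgue (minkowski_comb s A t B) =
      measure lebesgue (minkowski_comb s (of_coords -` A) t (of_coords -` B))" for s
    by (simp add: measure_of_coords_vimage of_coords_vimage_minkowski_comb[symmetric])
  then show ?thesis
    using poly_on_nonneg_measure_comb_cart[OF convex_body_of_coords_vimage[OF A] convex_body_of_coords_vimage[OF B] t]
    by simp
qed

lemma measure_minkowski_comb_scale:
  fixes A B :: "'a::euclidean_space set"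
  assumes "c \<ge> 0"
  shows "measure lebesgue (minkowski_comb (c * s) A (c * t) B) =
    c ^ DIM('a) * measure lebesgue (minkowski_comb s A t B)"
proof -
  have "minkowski_comb (c * s) A (c * t) B = (\<lambda>x. c *\<^sub>R x + 0) ` minkowski_comb s A t B"
    by (force simp: minkowski_comb_def scaleR_add_right)
  then show ?thesis
    using measure_lebesgue_affine[of c 0 "minkowski_comb s A t B"] assms by simp
qed

text \<open>Homogeneity extends the one-variable polynomials in
  \<open>s\<close> and in \<open>t\<close> to the quadrant; only the boundary \<open>t = 0\<close> needs a limit.\<close>

theorem measure_minkowski_comb_polynomial:
  fixes A B :: "'a::euclidean_space set"
  assumes A: "convex_body A" and B: "convex_body B"
  obtains c where "\<And>s t. s \<ge> 0 \<Longrightarrow> t \<ge> 0 \<Longrightarrow>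
    measure lebesgue (minkowski_comb s A t B) = (\<Sum>j\<le>DIM('a). c j * s ^ j * t ^ (DIM('a) - j))"
proof -
  let ?N = "DIM('a)"
  let ?F = "\<lambda>s t. measure lebesgue (minkowski_comb s A t B)"
  obtain p where p: "degree p \<le> ?N" "\<And>s. s \<ge> 0 \<Longrightarrow> ?F s 1 = poly p s"
    using poly_on_nonneg_measure_comb[OF A B, of 1] by (auto simp: poly_on_nonneg_def)
  obtain q where q: "\<And>t. t \<ge> 0 \<Longrightarrow> ?F 1 t = poly q t"
    using poly_on_nonneg_measure_comb[OF B A, of 1]
    by (auto simp: poly_on_nonneg_def minkowski_comb_commute[of 1 A])
  have p_eq: "poly p s = (\<Sum>j\<le>?N. coeff p j * s ^ j)" for s
    using p(1) unfolding poly_altdef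
    by (intro sum.mono_neutral_left) (auto simp: coeff_eq_0)
  have pos: "?F s t = (\<Sum>j\<le>?N. coeff p j * s ^ j * t ^ (?N - j))" if "s \<ge> 0" "t > 0" for s t
  proof -
    have "?F s t = t ^ ?N * ?F (s / t) 1"
      using measure_minkowski_comb_scale[of t "s / t" A 1 B] that by simp
    also have "\<dots> = (\<Sum>j\<le>?N. t ^ ?N * (coeff p j * (s / t) ^ j))"
      using that by (simp add: p p_eq sum_distrib_left)
    also have "\<dots> = (\<Sum>j\<le>?N. coeff p j * s ^ j * t ^ (?N - j))"
      using that by (intro sum.cong refl) (simp add: power_divide power_diff divide_simps)
    finally show ?thesis .
  qed
  \<comment> \<open>Rescaling to t = 1 is impossible at t = 0. The polynomial \<open>q\<close> shows
    that the volume is continuous in t there, so the formula for t > 0 passes to the limit, where 0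
    ^ (N - j) leaves the top coefficient.\<close>
  have zero: "?F 1 0 = coeff p ?N"
  proof -
    have lim_q: "(poly q \<longlongrightarrow> poly q 0) (at_right 0)"
      by (intro tendsto_intros)
    have lim_p: "((\<lambda>t. \<Sum>j\<le>?N. coeff p j * 1 ^ j * t ^ (?N - j)) \<longlongrightarrow>
        (\<Sum>j\<le>?N. coeff p j * 1 ^ j * 0 ^ (?N - j))) (at_right 0)"
      by (intro tendsto_intros)
    have ev: "\<forall>\<^sub>F t in at_right 0. (\<Sum>j\<le>?N. coeff p j * 1 ^ j * t ^ (?N - j)) = poly q t"
      using eventually_at_right_less
    proof eventually_elim
      case (elim t)
      then show ?case using pos[of 1 t] q[of t] by simp
    qed
    have "poly q 0 = (\<Sum>j\<le>?N. coeff p j * 1 ^ j * 0 ^ (?N - j))"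
      by (rule tendsto_unique[OF trivial_limit_at_right_real lim_q tendsto_cong[THEN iffD1, OF ev lim_p]])
    also have "\<dots> = (\<Sum>j\<le>?N. if j = ?N then coeff p j else 0)"
      by (intro sum.cong refl) (auto simp: power_0_left)
    finally show ?thesis using q[of 0] by simp
  qed
  show thesis
  proof (rule that)
    fix s t :: real assume st: "s \<ge> 0" "t \<ge> 0"
    show "?F s t = (\<Sum>j\<le>?N. coeff p j * s ^ j * t ^ (?N - j))"
    proof (cases "t = 0")
      case True
      have "?F s 0 = s ^ ?N * ?F 1 0"
        using measure_minkowski_comb_scale[of s 1 A 0 B] st by simp
      also have "\<dots> = (\<Sum>j\<le>?N. if j = ?N then coeff p j * s ^ j else 0)"
        by (simp add: zero)
      also have "\<dots> = (\<Sum>j\<le>?N. coeff p j * s ^ j * 0 ^ (?N - j))"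
        by (intro sum.cong refl) (auto simp: power_0_left)
      finally show ?thesis using True by simp
    qed (use pos st in auto)
  qed
qed

section \<open>Mixed volumes of two bodies\<close>

text \<open>Division by s + t turns the sum into a convex combination. Both the collapse of repeated
  summands and the inclusions in the convolution inequality rest on this.\<close>

lemma scaleR_add_in_scaled_convex:
  fixes A :: "'a::real_vector set"
  assumes "convex A" "x \<in> A" "y \<in> A" and st: "s \<ge> 0" "t \<ge> 0"
  shows "s *\<^sub>R x + t *\<^sub>R y \<in> (\<lambda>x. (s + t) *\<^sub>R x) ` A"
proof (cases "s + t = 0")
  case True
  then have "s = 0" "t = 0" using st by auto
  then show ?thesis using assms(2) by auto
next
  case False
  let ?u = "s / (s + t)" and ?v = "t / (s + t)"
  have "?u *\<^sub>R x + ?v *\<^sub>R y \<in> A"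
    using st False by (intro convexD[OF assms(1-3)]) (auto simp: add_divide_distrib[symmetric])
  moreover have "s *\<^sub>R x + t *\<^sub>R y = (s + t) *\<^sub>R (?u *\<^sub>R x + ?v *\<^sub>R y)"
    using False by (simp add: scaleR_add_right)
  ultimately show ?thesis by blast
qed

lemma sum_scaled_convex:
  fixes A :: "'a::real_vector set"
  assumes "convex A" "A \<noteq> {}" "finite I" "\<And>i. i \<in> I \<Longrightarrow> t i \<ge> 0"
  shows "(\<Sum>i\<in>I. (\<lambda>x. t i *\<^sub>R x) ` A) = (\<lambda>x. sum t I *\<^sub>R x) ` A"
  using assms(3,4)
proof (induction rule: finite_induct)
  case empty
  then show ?case using assms(2) by (auto simp: set_zero)
next
  case (insert i I)
  then have t: "t i \<ge> 0" "sum t I \<ge> 0" by (auto intro: sum_nonneg)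
  have "(\<lambda>x. t i *\<^sub>R x) ` A + (\<lambda>x. sum t I *\<^sub>R x) ` A = (\<lambda>x. (t i + sum t I) *\<^sub>R x) ` A"
  proof (intro equalityI subsetI)
    fix z assume "z \<in> (\<lambda>x. t i *\<^sub>R x) ` A + (\<lambda>x. sum t I *\<^sub>R x) ` A"
    then show "z \<in> (\<lambda>x. (t i + sum t I) *\<^sub>R x) ` A"
      using assms(1) t by (auto elim!: set_plus_elim intro: scaleR_add_in_scaled_convex)
  next
    fix z assume "z \<in> (\<lambda>x. (t i + sum t I) *\<^sub>R x) ` A"
    then show "z \<in> (\<lambda>x. t i *\<^sub>R x) ` A + (\<lambda>x. sum t I *\<^sub>R x) ` A"
      by (auto simp: scaleR_add_left)
  qed
  then show ?case using insert by simp
qed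

text \<open>The volume in the definition of \<open>mixed_volume\<close> thus depends on its N
  variables through two partial sums, which reduces the N-fold derivative to a derivative in two
  variables.\<close>

lemma sum_scaled_two_convex_bodies:
  fixes A B :: "'a::real_vector set"
  assumes A: "convex A" "A \<noteq> {}" and B: "convex B" "B \<noteq> {}" and j: "j \<le> N"
    and t: "\<And>i. i < N \<Longrightarrow> t i \<ge> 0"
  shows "(\<Sum>i<N. (\<lambda>x. t i *\<^sub>R x) ` ((replicate j A @ replicate (N - j) B) ! i)) =
    minkowski_comb (\<Sum>i<j. t i) A (\<Sum>i=j..<N. t i) B"
proof -
  let ?K = "replicate j A @ replicate (N - j) B"
  have split: "{..<N} = {..<j} \<union> {j..<N}" using j by auto
  have "(\<Sum>i<N. (\<lambda>x. t i *\<^sub>R x) ` (?K ! i)) =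
      (\<Sum>i<j. (\<lambda>x. t i *\<^sub>R x) ` (?K ! i)) + (\<Sum>i=j..<N. (\<lambda>x. t i *\<^sub>R x) ` (?K ! i))"
    unfolding split by (rule sum.union_disjoint) auto
  also have "\<dots> = (\<Sum>i<j. (\<lambda>x. t i *\<^sub>R x) ` A) + (\<Sum>i=j..<N. (\<lambda>x. t i *\<^sub>R x) ` B)"
    by (intro arg_cong2[where f="(+)"] sum.cong refl) (auto simp: nth_append)
  also have "\<dots> = (\<lambda>x. (\<Sum>i<j. t i) *\<^sub>R x) ` A + (\<lambda>x. (\<Sum>i=j..<N. t i) *\<^sub>R x) ` B"
    using t j by (intro arg_cong2[where f="(+)"] sum_scaled_convex A B) auto
  also have "\<dots> = minkowski_comb (\<Sum>i<j. t i) A (\<Sum>i=j..<N. t i) B"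
    by (auto simp: minkowski_comb_def set_plus_def)
  finally show ?thesis .
qed

text \<open>\<open>g\<close> extends \<open>f\<close> across the boundary of the orthant, so
  ordinary two-sided differentiation rules apply. The one-sided derivative is unique because every
  point of the half-line is a limit point of it.\<close>

lemma orthant_partial_eq:
  assumes "t i \<ge> 0" and f: "\<And>s. s \<ge> 0 \<Longrightarrow> f (t(i := s)) = g s"
    and g: "(g has_real_derivative g') (at (t i))"
  shows "orthant_partial i f t = g'"
  unfolding orthant_partial_def
proof (rule vector_derivative_within)
  have "t i islimpt {t i..t i + 1}" by (simp add: islimpt_Icc)
  then have "t i islimpt {0..}" by (rule islimpt_subset) (use assms(1) in auto)
  then show "at (t i) within {0..} \<noteq> bot" by (simp add: trivial_limit_within)
  have "(g has_vector_derivative g') (at (t i) within {0..})"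
    using g by (simp add: has_real_derivative_iff_has_vector_derivative has_vector_derivative_at_within)
  then show "((\<lambda>s. f (t(i := s))) has_vector_derivative g') (at (t i) within {0..})"
    by (rule has_vector_derivative_transform[rotated 2]) (use assms(1) f in auto)
qed

lemma mixed_volume_two_bodies:
  fixes A B :: "'a::euclidean_space set"
  assumes A: "convex_body A" and B: "convex_body B" and j: "j \<le> DIM('a)"
    and c: "\<And>s t. s \<ge> 0 \<Longrightarrow> t \<ge> 0 \<Longrightarrow>
      measure lebesgue (minkowski_comb s A t B) = (\<Sum>k\<le>DIM('a). c k * s ^ k * t ^ (DIM('a) - k))"
  shows "mixed_volume (replicate j A @ replicate (DIM('a) - j) B) = c j / (DIM('a) choose j)"
proof -
  let ?N = "DIM('a)"
  let ?K = "replicate j A @ replicate (?N - j) B"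
  define f where "f t = measure lebesgue (\<Sum>i<?N. (\<lambda>x. t i *\<^sub>R x) ` (?K ! i))" for t
  \<comment> \<open>The p-fold derivative in \<open>s\<close> and q-fold derivative in
    \<open>t\<close> of the volume polynomial. Iterating \<open>pderiv\<close> on monomials handles
    exponents that are too small without case distinctions.\<close>
  define P where "P p q s t = (\<Sum>k\<le>?N. c k * poly ((pderiv ^^ p) (monom 1 k)) s *
    poly ((pderiv ^^ q) (monom 1 (?N - k))) t)" for p q s t
  have AB: "convex A" "A \<noteq> {}" "convex B" "B \<noteq> {}" using A B by (auto simp: convex_body_def)
  have deriv1: "((\<lambda>s. P p q s t) has_real_derivative P (Suc p) q s t) (at s)" for p q s t
    unfolding P_def by (auto intro!: derivative_eq_intros poly_DERIV simp: mult_ac)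
  have deriv2: "((\<lambda>t. P p q s t) has_real_derivative P p (Suc q) s t) (at t)" for p q s t
    unfolding P_def by (auto intro!: derivative_eq_intros poly_DERIV simp: mult_ac)
  \<comment> \<open>The fold differentiates in the highest index first, hence the downward
    induction. Among the indices from \<open>m\<close> on, \<open>j - m\<close> (truncated at 0)
    belong to the first body and differentiate in \<open>s\<close>; the remaining
    \<open>?N - max m j\<close> differentiate in \<open>t\<close>.\<close>
  have partials: "foldr orthant_partial [m..<?N] f t = P (j - m) (?N - max m j) (\<Sum>i<j. t i) (\<Sum>i=j..<?N. t i)"
    if "m \<le> ?N" "\<And>i. i < ?N \<Longrightarrow> t i \<ge> 0" for m t
    using that
  proof (induction m arbitrary: t rule: inc_induct)
    case base
    have "f t = (\<Sum>k\<le>?N. c k * (\<Sum>i<j. t i) ^ k * (\<Sum>i=j..<?N. t i) ^ (?N - k))"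
      unfolding f_def using base j
      by (subst sum_scaled_two_convex_bodies[OF AB j]) (auto intro!: c sum_nonneg)
    then show ?case using j by (simp add: P_def poly_monom)
  next
    case (step m)
    have upt: "[m..<?N] = m # [Suc m..<?N]" using step.hyps by (simp add: upt_conv_Cons)
    have IH: "foldr orthant_partial [Suc m..<?N] f (t(m := s)) =
      P (j - Suc m) (?N - max (Suc m) j) (\<Sum>i<j. (t(m := s)) i) (\<Sum>i=j..<?N. (t(m := s)) i)"
      if "s \<ge> 0" for s
      using step.prems that by (intro step.IH) auto
    have same: "(\<Sum>i\<in>I. (t(m := s)) i) = sum t I" if "m \<notin> I" for s and I :: "nat set"
      using that by (intro sum.cong) auto
    have other: "(\<Sum>i\<in>I. (t(m := s)) i) = s + sum t (I - {m})" if "m \<in> I" "finite I" for s and I :: "nat set"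
      using that by (subst sum.remove[of I m]) (auto intro!: sum.cong)
    have tm: "t m \<ge> 0" using step by auto
    show ?case
    proof (cases "m < j")
      case True
      let ?r = "sum t ({..<j} - {m})"
      have d: "((\<lambda>s. P (j - Suc m) (?N - j) (s + ?r) (\<Sum>i=j..<?N. t i)) has_real_derivative
          P (Suc (j - Suc m)) (?N - j) (t m + ?r) (\<Sum>i=j..<?N. t i)) (at (t m))"
        using deriv1 by (subst DERIV_shift[symmetric])
      have e: "t m + ?r = (\<Sum>i<j. t i)" using True by (subst sum.remove[of _ m]) auto
      have v: "foldr orthant_partial [Suc m..<?N] f (t(m := s)) =
          P (j - Suc m) (?N - j) (s + ?r) (\<Sum>i=j..<?N. t i)" if "s \<ge> 0" for s
        using IH[OF that] True by (simp add: same other max_def del: fun_upd_apply)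
      have "foldr orthant_partial [m..<?N] f t = P (Suc (j - Suc m)) (?N - j) (t m + ?r) (\<Sum>i=j..<?N. t i)"
        unfolding upt foldr.simps o_apply by (rule orthant_partial_eq[where t=t and i=m, OF tm v d])
      then show ?thesis using True by (simp add: e Suc_diff_Suc max_def)
    next
      case False
      let ?r = "sum t ({j..<?N} - {m})"
      have d: "((\<lambda>s. P 0 (?N - Suc m) (\<Sum>i<j. t i) (s + ?r)) has_real_derivative
          P 0 (Suc (?N - Suc m)) (\<Sum>i<j. t i) (t m + ?r)) (at (t m))"
        using deriv2 by (subst DERIV_shift[symmetric])
      have e: "t m + ?r = (\<Sum>i=j..<?N. t i)" using False step.hyps by (subst sum.remove[of _ m]) auto
      have v: "foldr orthant_partial [Suc m..<?N] f (t(m := s)) =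
          P 0 (?N - Suc m) (\<Sum>i<j. t i) (s + ?r)" if "s \<ge> 0" for s
        using IH[OF that] False step.hyps by (simp add: same other max_def del: fun_upd_apply)
      have "foldr orthant_partial [m..<?N] f t = P 0 (Suc (?N - Suc m)) (\<Sum>i<j. t i) (t m + ?r)"
        unfolding upt foldr.simps o_apply by (rule orthant_partial_eq[where t=t and i=m, OF tm v d])
      then show ?thesis using False step.hyps by (simp add: e Suc_diff_Suc max_def)
    qed
  qed
  \<comment> \<open>At the origin a monomial survives only if it is differentiated exactly as often
    as its degree. So the coefficient with index \<open>j\<close> is selected, with factor j! (N -
    j)!.\<close>
  have deriv0: "poly ((pderiv ^^ p) (monom 1 k)) (0::real) = (if k = p then fact p else 0)" for p k
    by (simp add: poly_0_coeff_0 coeff_higher_pderiv pochhammer_fact)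
  have "foldr orthant_partial [0..<?N] f (\<lambda>_. 0) = P j (?N - j) 0 0"
    using partials[of 0 "\<lambda>_. 0"] by simp
  also have "\<dots> = (\<Sum>k\<le>?N. if k = j then c j * fact j * fact (?N - j) else 0)"
    unfolding P_def deriv0 using j by (intro sum.cong refl) auto
  also have "\<dots> = c j * (fact j * fact (?N - j))"
    using j by simp
  finally show ?thesis
    unfolding mixed_volume_def f_def[symmetric]
    using j by (simp add: binomial_fact)
qed

corollary measure_minkowski_comb_mixed_volume:
  fixes A B :: "'a::euclidean_space set"
  assumes A: "convex_body A" and B: "convex_body B" and "s \<ge> 0" "t \<ge> 0"
  shows "measure lebesgue (minkowski_comb s A t B) = (\<Sum>j\<le>DIM('a). (DIM('a) choose j) *
    mixed_volume (replicate j A @ replicate (DIM('a) - j) B) * s ^ j * t ^ (DIM('a) - j))"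
proof -
  obtain c where c: "\<And>s t. s \<ge> 0 \<Longrightarrow> t \<ge> 0 \<Longrightarrow>
      measure lebesgue (minkowski_comb s A t B) = (\<Sum>j\<le>DIM('a). c j * s ^ j * t ^ (DIM('a) - j))"
    using measure_minkowski_comb_polynomial[OF A B] by blast
  show ?thesis
    unfolding c[OF assms(3,4)]
    by (intro sum.cong refl) (simp add: mixed_volume_two_bodies[OF A B _ c])
qed

section \<open>The diagonal and the power of a body\<close>

lemma convex_body_uminus_diagonal:
  fixes K :: "(real ^ 'n) set"
  assumes "convex_body K"
  shows "convex_body (uminus ` (diagonal_embedding ` K :: (real ^ 'n ^ 'p) set))"
proof -
  have linear: "linear (\<lambda>x :: real ^ 'n. - (diagonal_embedding x :: real ^ 'n ^ 'p))"
    by (auto simp: linear_iff diagonal_embedding_def vec_eq_iff)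
  have K: "compact K" "convex K" "K \<noteq> {}" using assms by (auto simp: convex_body_def)
  show ?thesis
    unfolding convex_body_def image_image
    using compact_continuous_image[OF linear_continuous_on K(1), OF linear[unfolded linear_conv_bounded_linear]]
      convex_linear_image[OF linear K(2)] K(3) by simp
qed

lemma convex_body_cartesian_power:
  fixes K :: "(real ^ 'n) set"
  assumes "convex_body K"
  shows "convex_body (cartesian_power K :: (real ^ 'n ^ 'p) set)"
proof -
  have K: "compact K" "convex K" "K \<noteq> {}" using assms by (auto simp: convex_body_def)
  have "cartesian_power K = (\<Inter>i. (\<lambda>x :: real ^ 'n ^ 'p. x $ i) -` K)"
    by (auto simp: cartesian_power_def)
  moreover have "closed ((\<lambda>x :: real ^ 'n ^ 'p. x $ i) -` K)" for i
    using K(1) by (intro continuous_closed_vimage compact_imp_closed) (auto intro: continuous_intros)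
  ultimately have "closed (cartesian_power K :: (real ^ 'n ^ 'p) set)" by auto
  moreover have "bounded (cartesian_power K :: (real ^ 'n ^ 'p) set)"
  proof -
    obtain M where M: "\<And>x. x \<in> K \<Longrightarrow> norm x \<le> M"
      using compact_imp_bounded[OF K(1)] by (auto simp: bounded_iff)
    have "norm x \<le> CARD('p) * M" if "x \<in> cartesian_power K" for x :: "real ^ 'n ^ 'p"
    proof -
      have "norm x \<le> (\<Sum>i\<in>UNIV. norm (x $ i))"
        unfolding norm_vec_def by (rule L2_set_le_sum) auto
      also have "\<dots> \<le> (\<Sum>i\<in>(UNIV :: 'p set). M)"
        using that M by (intro sum_mono) (auto simp: cartesian_power_def)
      finally show ?thesis by simp
    qed
    then show ?thesis unfolding bounded_iff by blast
  qed
  moreover have "convex (cartesian_power K :: (real ^ 'n ^ 'p) set)"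
    using K(2) by (auto simp: cartesian_power_def convex_def)
  moreover obtain k where "k \<in> K" using K(3) by blast
  then have "(\<chi> i. k) \<in> (cartesian_power K :: (real ^ 'n ^ 'p) set)"
    by (simp add: cartesian_power_def)
  ultimately show ?thesis
    by (auto simp: convex_body_def compact_eq_bounded_closed)
qed

section \<open>Lebesgue measure of a Cartesian power\<close>

lemma prod_Basis_vec:
  "(\<Prod>b\<in>Basis. f b) = (\<Prod>i\<in>UNIV. \<Prod>b\<in>Basis. f (axis i (b :: 'a::euclidean_space) :: 'a ^ 'p))"
proof -
  have "bij_betw (\<lambda>x. axis (fst x) (snd x)) (UNIV \<times> Basis) (Basis :: ('a ^ 'p) set)"
    by (force simp: bij_betw_def inj_on_def axis_eq_axis Basis_vec_def nonzero_Basis)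
  from prod.reindex_bij_betw[OF this, of f] show ?thesis
    by (simp add: prod.cartesian_product case_prod_unfold)
qed

lemma borel_measurable_vec_lambda [measurable]:
  "(\<lambda>f. \<chi> i. f i) \<in> (\<Pi>\<^sub>M i\<in>UNIV. lborel) \<rightarrow>\<^sub>M (borel :: ('a::euclidean_space ^ 'p) measure)"
proof (rule borel_measurable_euclidean_space[THEN iffD2], rule ballI)
  fix b :: "'a ^ 'p" assume "b \<in> Basis"
  then obtain i b' where b: "b = axis i b'" by (auto simp: Basis_vec_def)
  have "(\<lambda>f :: 'p \<Rightarrow> 'a. f i) \<in> (\<Pi>\<^sub>M i\<in>UNIV. lborel) \<rightarrow>\<^sub>M borel"
    using measurable_component_singleton[of i UNIV "\<lambda>_. lborel :: 'a measure"] by simp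
  then show "(\<lambda>f :: 'p \<Rightarrow> 'a. (\<chi> i. f i) \<bullet> b) \<in> borel_measurable (\<Pi>\<^sub>M i\<in>UNIV. lborel)"
    by (simp add: b inner_axis)
qed

text \<open>It suffices to compare boxes: a box of the power is a product of boxes, and its side
  lengths are those of the factors taken together.\<close>

lemma distr_PiM_vec_lambda:
  "distr (\<Pi>\<^sub>M i\<in>UNIV. lborel) borel (\<lambda>f. \<chi> i. f i) = (lborel :: ('a::euclidean_space ^ 'p) measure)"
proof (rule lborel_eqI[symmetric])
  interpret product_sigma_finite "\<lambda>_ :: 'p. lborel :: 'a measure" ..
  fix l u :: "'a ^ 'p" assume le: "\<And>b. b \<in> Basis \<Longrightarrow> l \<bullet> b \<le> u \<bullet> b"
  have le': "l $ i \<bullet> b \<le> u $ i \<bullet> b" if "b \<in> Basis" for i b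
    using le[of "axis i b"] that by (auto simp: inner_axis Basis_vec_def)
  have "(\<lambda>f. \<chi> i. f i) -` box l u \<inter> space (\<Pi>\<^sub>M i\<in>UNIV. lborel) = (\<Pi>\<^sub>E i\<in>UNIV. box (l $ i) (u $ i))"
    by (auto simp: space_PiM box_def Basis_vec_def inner_axis PiE_iff)
  then have "emeasure (distr (\<Pi>\<^sub>M i\<in>UNIV. lborel) borel (\<lambda>f. \<chi> i. f i)) (box l u) =
      emeasure (\<Pi>\<^sub>M i\<in>UNIV. lborel) (\<Pi>\<^sub>E i\<in>UNIV. box (l $ i) (u $ i))"
    by (simp add: emeasure_distr)
  also have "\<dots> = (\<Prod>i\<in>UNIV. emeasure lborel (box (l $ i) (u $ i)))"
    by (rule emeasure_PiM) auto
  also have "\<dots> = (\<Prod>i\<in>UNIV. ennreal (\<Prod>b\<in>Basis. (u $ i - l $ i) \<bullet> b))"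
    using le' by simp
  also have "\<dots> = ennreal (\<Prod>i\<in>UNIV. \<Prod>b\<in>Basis. (u $ i - l $ i) \<bullet> b)"
    using le' by (intro prod_ennreal prod_nonneg) (auto simp: inner_diff_left)
  also have "\<dots> = ennreal (\<Prod>b\<in>Basis. (u - l) \<bullet> b)"
    by (simp add: prod_Basis_vec inner_axis)
  finally show "emeasure (distr (\<Pi>\<^sub>M i\<in>UNIV. lborel) borel (\<lambda>f. \<chi> i. f i)) (box l u) =
    (\<Prod>b\<in>Basis. (u - l) \<bullet> b)" .
qed simp

lemma measure_cartesian_power:
  fixes K :: "(real ^ 'n) set"
  assumes "convex_body K"
  shows "measure lebesgue (cartesian_power K :: (real ^ 'n ^ 'p) set) = measure lebesgue K ^ CARD('p)"
proof -
  interpret product_sigma_finite "\<lambda>_ :: 'p. lborel :: (real ^ 'n) measure" ..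
  let ?P = "\<Pi>\<^sub>M i\<in>(UNIV :: 'p set). (lborel :: (real ^ 'n) measure)"
  have K: "K \<in> sets borel" and KP: "(cartesian_power K :: (real ^ 'n ^ 'p) set) \<in> sets borel"
    using assms convex_body_cartesian_power[OF assms, where 'p='p] by (simp_all add: convex_body_def borel_compact)
  have "measure (distr ?P borel (\<lambda>f. \<chi> i. f i)) (cartesian_power K :: (real ^ 'n ^ 'p) set) =
      measure ?P ((\<lambda>f. \<chi> i. f i) -` (cartesian_power K :: (real ^ 'n ^ 'p) set) \<inter> space ?P)"
    by (intro measure_distr KP borel_measurable_vec_lambda)
  also have "(\<lambda>f. \<chi> i. f i) -` (cartesian_power K :: (real ^ 'n ^ 'p) set) \<inter> space ?P = (\<Pi>\<^sub>E i\<in>UNIV. K)"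
    by (auto simp: space_PiM cartesian_power_def PiE_iff)
  also have "measure ?P (\<Pi>\<^sub>E i\<in>UNIV. K) = measure lborel K ^ CARD('p)"
  proof -
    have "enn2real (x ^ k) = enn2real x ^ k" for x k
      by (induction k) (simp_all add: enn2real_mult)
    then show ?thesis
      unfolding measure_def using K by (subst emeasure_PiM) simp_all
  qed
  finally show ?thesis
    using K KP by (simp add: distr_PiM_vec_lambda)
qed

section \<open>The convolution inequality for the diagonal\<close>

lemma nn_integral_lborel_swap:
  fixes f :: "'a::euclidean_space \<Rightarrow> 'b::euclidean_space \<Rightarrow> ennreal"
  assumes "case_prod f \<in> borel_measurable (borel \<Otimes>\<^sub>M borel)"
  shows "(\<integral>\<^sup>+x. \<integral>\<^sup>+y. f x y \<partial>lborel \<partial>lborel) = (\<integral>\<^sup>+y. \<integral>\<^sup>+x. f x y \<partial>lborel \<partial>lborel)"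
proof -
  have "case_prod f \<in> borel_measurable (lborel \<Otimes>\<^sub>M lborel)"
    using assms by (simp only: measurable_cong_sets[OF sets_pair_measure_cong[OF sets_lborel sets_lborel] refl])
  from lborel_pair.Fubini'[OF this] show ?thesis ..
qed

lemma nn_integral_power_Icc:
  assumes "n > 0" "T \<ge> 0"
  shows "(\<integral>\<^sup>+x. ennreal (n * x ^ (n - 1)) * indicator {0..T} x \<partial>lborel) = ennreal (T ^ n)"
proof -
  have "(\<integral>\<^sup>+x. ennreal (n * x ^ (n - 1)) * indicator {0..T} x \<partial>lborel) = ennreal (T ^ n - 0 ^ n)"
    by (rule nn_integral_FTC_Icc) (use assms in \<open>auto intro!: derivative_eq_intros\<close>)
  then show ?thesis using assms by simp
qed

lemma emeasure_lborel_affine_compact: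
  fixes S :: "'a::euclidean_space set"
  assumes "compact S" "r \<ge> 0"
  shows "emeasure lborel ((\<lambda>x. r *\<^sub>R x + d) ` S) = ennreal (r ^ DIM('a) * measure lebesgue S)"
proof -
  have "compact ((\<lambda>x. r *\<^sub>R x + d) ` S)"
    using assms(1) by (intro compact_continuous_image continuous_intros)
  then have "emeasure lborel ((\<lambda>x. r *\<^sub>R x + d) ` S) = emeasure lebesgue ((\<lambda>x. r *\<^sub>R x + d) ` S)"
    by (simp add: borel_compact)
  also have "\<dots> = ennreal (r ^ DIM('a)) * emeasure lebesgue S"
    using emeasure_lebesgue_affine[of r d S] assms(2) by simp
  also have "\<dots> = ennreal (r ^ DIM('a) * measure lebesgue S)"
    using assms by (simp add: ennreal_mult emeasure_eq_measure2 lmeasurable_compact)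
  finally show ?thesis .
qed

text \<open>The graph is a continuous image of the compact set
  \<open>{0..m} \<times> A \<times> B\<close>. Its measurability is what the exchange of the
  integrals over \<open>r\<close> and \<open>y\<close> requires.\<close>

lemma minkowski_comb_graph_in_sets:
  fixes A B :: "'a::euclidean_space set"
  assumes "compact A" "compact B"
  shows "{(r, y). r \<in> {0..m} \<and> y \<in> minkowski_comb (s - r) A (t - r) B} \<in> sets (borel \<Otimes>\<^sub>M borel)"
proof -
  let ?h = "\<lambda>(r, a, b). (r, (s - r) *\<^sub>R a + (t - r) *\<^sub>R b)"
  have eq: "{(r, y). r \<in> {0..m} \<and> y \<in> minkowski_comb (s - r) A (t - r) B} = ?h ` ({0..m} \<times> A \<times> B)"
    by (force simp: minkowski_comb_def)
  have "compact (?h ` ({0..m} \<times> A \<times> B))"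
    using assms unfolding case_prod_unfold
    by (intro compact_continuous_image continuous_intros compact_Times compact_Icc)
  then show ?thesis unfolding eq borel_prod by (rule borel_compact)
qed

text \<open>A convex null set lies in a hyperplane <a, x> = b, and then one block coordinate of
  every point of the combination lies in <a, x> = (t - s) b. This separates the case in which
  division by the volume of \<open>K\<close> is impossible.\<close>

lemma measure_minkowski_comb_diagonal_eq_0:
  fixes K :: "(real ^ 'n) set"
  assumes "convex_body K" "measure lebesgue K = 0"
  shows "measure lebesgue (minkowski_comb s (uminus ` diagonal_embedding ` K) t
    (cartesian_power K :: (real ^ 'n ^ 'p) set)) = 0"
proof -
  have K: "compact K" "convex K" using assms by (auto simp: convex_body_def)
  have "negligible K"
    using assms(2) K(1) by (simp add: negligible_iff_measure lmeasurable_compact)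
  then have "interior K = {}"
    by (metis interior_subset negligible_subset open_interior open_not_negligible)
  then obtain a b where ab: "a \<noteq> 0" "K \<subseteq> {x. a \<bullet> x = b}"
    using empty_interior_subset_hyperplane[OF K(2)] by metis
  fix i0 :: 'p
  have "minkowski_comb s (uminus ` diagonal_embedding ` K) t (cartesian_power K :: (real ^ 'n ^ 'p) set) \<subseteq>
      {y. axis i0 a \<bullet> y = (t - s) * b}" (is "?S \<subseteq> ?H")
  proof
    fix y :: "real ^ 'n ^ 'p" assume "y \<in> ?S"
    then obtain k z where kz: "k \<in> K" "z \<in> cartesian_power K" "y = s *\<^sub>R (- diagonal_embedding k) + t *\<^sub>R z"
      by (auto simp: minkowski_comb_def)
    then have "a \<bullet> k = b" "a \<bullet> z $ i0 = b"
      using ab(2) by (auto simp: cartesian_power_def)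
    then show "y \<in> ?H"
      by (simp add: kz(3) diagonal_embedding_def inner_axis' inner_add_right inner_diff_right algebra_simps)
  qed
  moreover have "negligible ?H"
    using ab(1) by (intro negligible_hyperplane) (simp add: axis_eq_0_iff)
  ultimately have "negligible ?S" using negligible_subset by blast
  then show ?thesis by (rule negligible_imp_measure0)
qed

text \<open>Both sides bound the integral over \<open>y\<close> of \<open>|{x \<in> sK. y\<^sub>i + x \<in> tK for all i}|\<close>. Its value is the
  right-hand side by Fubini, while for \<open>y = (t - r) k - (s - r) \<Delta>x\<close> the set contains a translate
  of \<open>rK\<close>.\<close>

lemma nn_integral_minkowski_comb_diagonal_le:
  fixes K :: "(real ^ 'n) set"
  assumes K: "convex_body K" and st: "s \<ge> 0" "t \<ge> 0"
  defines "S r \<equiv> minkowski_comb (s - r) (uminus ` diagonal_embedding ` K) (t - r)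
    (cartesian_power K :: (real ^ 'n ^ 'p) set)"
  shows "(\<integral>\<^sup>+r. ennreal (CARD('n) * r ^ (CARD('n) - 1) * measure lebesgue (S r)) *
      indicator {0..min s t} r \<partial>lborel)
    \<le> ennreal (s ^ CARD('n) * t ^ (CARD('n) * CARD('p)) * measure lebesgue K ^ CARD('p))"
proof (cases "measure lebesgue K = 0")
  case True
  then show ?thesis
    using measure_minkowski_comb_diagonal_eq_0[OF K True, where 'p='p] by (simp add: S_def)
next
  case False
  let ?n = "CARD('n)" and ?N = "CARD('n) * CARD('p)"
  define A where "A = (uminus ` diagonal_embedding ` K :: (real ^ 'n ^ 'p) set)"
  define B where "B = (cartesian_power K :: (real ^ 'n ^ 'p) set)"
  define M where "M = measure lebesgue K"
  have M: "M > 0" using False by (simp add: M_def zero_less_measure_iff)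
  have cK: "compact K" "convex K" "K \<noteq> {}" using K by (auto simp: convex_body_def)
  have cA: "compact A" and cB: "compact B"
    using convex_body_uminus_diagonal[OF K, where 'p='p] convex_body_cartesian_power[OF K, where 'p='p]
    by (simp_all add: A_def B_def convex_body_def)
  have S: "S r = minkowski_comb (s - r) A (t - r) B" for r by (simp add: S_def A_def B_def)
  define Z where "Z = {(y :: real ^ 'n ^ 'p, x). x \<in> (\<lambda>x. s *\<^sub>R x) ` K \<and> (\<forall>i. y $ i + x \<in> (\<lambda>x. t *\<^sub>R x) ` K)}"
  have c_scaled: "compact ((\<lambda>x. r *\<^sub>R x) ` K)" for r
    using cK(1) by (rule compact_scaling)
  have "closed Z"
  proof -
    have "Z = (\<lambda>z. snd z) -` ((\<lambda>x. s *\<^sub>R x) ` K) \<inter> (\<Inter>i. (\<lambda>z. fst z $ i + snd z) -` ((\<lambda>x. t *\<^sub>R x) ` K))"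
      by (auto simp: Z_def)
    moreover have "closed ((\<lambda>z :: (real ^ 'n ^ 'p) \<times> (real ^ 'n). snd z) -` ((\<lambda>x. s *\<^sub>R x) ` K))"
      by (intro continuous_closed_vimage compact_imp_closed c_scaled) (auto intro: continuous_intros)
    moreover have "closed ((\<lambda>z :: (real ^ 'n ^ 'p) \<times> (real ^ 'n). fst z $ i + snd z) -` ((\<lambda>x. t *\<^sub>R x) ` K))" for i
      by (intro continuous_closed_vimage compact_imp_closed c_scaled) (auto intro!: continuous_intros)
    ultimately show ?thesis by auto
  qed
  then have Z: "Z \<in> sets (borel \<Otimes>\<^sub>M borel)" unfolding borel_prod by (rule borel_closed)
  define f where "f y = emeasure lborel {x. (y, x) \<in> Z}" for y
  have f_eq: "f y = (\<integral>\<^sup>+x. indicator Z (y, x) \<partial>lborel)" for y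
  proof -
    have "{x. (y, x) \<in> Z} = Pair y -` Z" by auto
    also have "\<dots> \<in> sets borel" using sets_Pair1[OF Z] .
    finally have "f y = (\<integral>\<^sup>+x. indicator {x. (y, x) \<in> Z} x \<partial>lborel)"
      by (simp add: f_def)
    also have "\<dots> = (\<integral>\<^sup>+x. indicator Z (y, x) \<partial>lborel)"
      by (intro nn_integral_cong) (simp add: indicator_def)
    finally show ?thesis .
  qed
  have f_integral: "(\<integral>\<^sup>+y. f y \<partial>lborel) = ennreal (s ^ ?n * M * (t ^ ?N * M ^ CARD('p)))"
  proof -
    have "(\<integral>\<^sup>+y. f y \<partial>lborel) = (\<integral>\<^sup>+x. \<integral>\<^sup>+y. indicator Z (y, x) \<partial>lborel \<partial>lborel)"
      unfolding f_eq using Z by (intro nn_integral_lborel_swap) (simp add: case_prod_unfold)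
    also have "\<dots> = (\<integral>\<^sup>+x. ennreal (t ^ ?N * M ^ CARD('p)) * indicator ((\<lambda>x. s *\<^sub>R x) ` K) x \<partial>lborel)"
    proof (intro nn_integral_cong)
      fix x
      \<comment> \<open>For fixed \<open>x\<close> the admissible \<open>y\<close> form the
        translate of \<open>t B\<close> by minus the diagonal image of \<open>x\<close>, so the
        inner integral does not depend on \<open>x\<close> as long as \<open>x\<close> lies in
        \<open>s K\<close>.\<close>
      let ?T = "(\<lambda>z. t *\<^sub>R z + (- diagonal_embedding x)) ` B"
      have T: "y \<in> ?T \<longleftrightarrow> (\<forall>i. y $ i + x \<in> (\<lambda>x. t *\<^sub>R x) ` K)" for y
      proof
        assume "\<forall>i. y $ i + x \<in> (\<lambda>x. t *\<^sub>R x) ` K"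
        then have "\<forall>i. \<exists>z. z \<in> K \<and> y $ i + x = t *\<^sub>R z" by blast
        then obtain z where "\<forall>i. z i \<in> K \<and> y $ i + x = t *\<^sub>R z i"
          by (rule choice[THEN exE])
        then have z: "\<And>i. z i \<in> K" "\<And>i. y $ i + x = t *\<^sub>R z i" by auto
        have "y $ i = t *\<^sub>R z i - x" for i using z(2)[of i] by (simp add: algebra_simps)
        then have "y = t *\<^sub>R (\<chi> i. z i) + (- diagonal_embedding x)"
          by (simp add: vec_eq_iff diagonal_embedding_def)
        then show "y \<in> ?T" using z(1) by (auto simp: B_def cartesian_power_def)
      qed (auto simp: B_def cartesian_power_def diagonal_embedding_def)
      have "compact ?T" using cB by (intro compact_continuous_image continuous_intros)
      then have "?T \<in> sets borel" by (rule borel_compact)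
      then have "(\<integral>\<^sup>+y. indicator ?T y \<partial>lborel) = emeasure lborel ?T" by simp
      also have "\<dots> = ennreal (t ^ ?N * M ^ CARD('p))"
        using emeasure_lborel_affine_compact[OF cB st(2), of "- diagonal_embedding x"] measure_cartesian_power[OF K, where 'p='p]
        by (simp add: B_def M_def mult.commute)
      finally have "(\<integral>\<^sup>+y. indicator ?T y \<partial>lborel) = ennreal (t ^ ?N * M ^ CARD('p))" .
      moreover have "indicator Z (y, x) = (indicator ?T y * indicator ((\<lambda>x. s *\<^sub>R x) ` K) x :: ennreal)" for y
        using T[of y] by (auto simp: Z_def indicator_def)
      ultimately show "(\<integral>\<^sup>+y. indicator Z (y, x) \<partial>lborel) =
          ennreal (t ^ ?N * M ^ CARD('p)) * indicator ((\<lambda>x. s *\<^sub>R x) ` K) x"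
        using \<open>?T \<in> sets borel\<close> by (simp add: nn_integral_multc)
    qed
    also have "\<dots> = ennreal (t ^ ?N * M ^ CARD('p)) * emeasure lborel ((\<lambda>x. s *\<^sub>R x + 0) ` K)"
      using borel_compact[OF c_scaled] by (simp add: nn_integral_cmult_indicator)
    also have "\<dots> = ennreal (s ^ ?n * M * (t ^ ?N * M ^ CARD('p)))"
      unfolding emeasure_lborel_affine_compact[OF cK(1) st(1)]
      using st M by (simp add: M_def[symmetric] ennreal_mult[symmetric] mult_ac)
    finally show ?thesis .
  qed
  have f_ge: "ennreal (r ^ ?n * M) \<le> f y" if r: "0 \<le> r" "r \<le> s" "r \<le> t" and y: "y \<in> S r" for r y
  proof -
    obtain k b where kb: "k \<in> K" "b \<in> B" "y = (s - r) *\<^sub>R (- diagonal_embedding k) + (t - r) *\<^sub>R b"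
      using y by (auto simp: S A_def minkowski_comb_def)
    \<comment> \<open>The shift (s - r) k is chosen to cancel the diagonal part of \<open>y\<close>:
      adding x = r z + (s - r) k to the i-th block leaves r z + (t - r) b_i, a point of
      \<open>t K\<close>.\<close>
    have "(\<lambda>z. r *\<^sub>R z + (s - r) *\<^sub>R k) ` K \<subseteq> {x. (y, x) \<in> Z}"
    proof
      fix x assume "x \<in> (\<lambda>z. r *\<^sub>R z + (s - r) *\<^sub>R k) ` K"
      then obtain z where z: "z \<in> K" "x = r *\<^sub>R z + (s - r) *\<^sub>R k" by blast
      have "x \<in> (\<lambda>x. s *\<^sub>R x) ` K"
        using scaleR_add_in_scaled_convex[OF cK(2) z(1) kb(1), of r "s - r"] r z(2) by simp
      moreover have "y $ i + x \<in> (\<lambda>x. t *\<^sub>R x) ` K" for i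
      proof -
        have "y $ i + x = r *\<^sub>R z + (t - r) *\<^sub>R (b $ i)"
          by (simp add: kb(3) z(2) diagonal_embedding_def)
        moreover have "b $ i \<in> K" using kb(2) by (simp add: B_def cartesian_power_def)
        ultimately show ?thesis
          using scaleR_add_in_scaled_convex[OF cK(2) z(1), of "b $ i" r "t - r"] r by simp
      qed
      ultimately show "x \<in> {x. (y, x) \<in> Z}" by (simp add: Z_def)
    qed
    moreover have "{x. (y, x) \<in> Z} \<in> sets lborel"
      using sets_Pair1[OF Z, of y] by (simp add: vimage_def)
    ultimately have "emeasure lborel ((\<lambda>z. r *\<^sub>R z + (s - r) *\<^sub>R k) ` K) \<le> f y"
      unfolding f_def by (rule emeasure_mono)
    then show ?thesis
      unfolding emeasure_lborel_affine_compact[OF cK(1) r(1)] by (simp add: M_def)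
  qed
  define W where "W = {(r, y). r \<in> {0..min s t} \<and> y \<in> S r}"
  have W: "W \<in> sets (borel \<Otimes>\<^sub>M borel)"
    unfolding W_def S by (rule minkowski_comb_graph_in_sets[OF cA cB])
  define g where "g r = ennreal (?n * r ^ (?n - 1))" for r :: real
  \<comment> \<open>Every \<open>r\<close> with \<open>y\<close> in \<open>S r\<close> satisfies r^n
    M <= f y, hence r <= T with T^n = f y / M. The weight \<open>g\<close> is the derivative of r^n,
    so its integral up to T is exactly f y / M.\<close>
  have inner: "(\<integral>\<^sup>+r. g r * indicator W (r, y) \<partial>lborel) \<le> f y * ennreal (1 / M)" for y
  proof (cases "f y" rule: ennreal_cases)
    case (real q)
    define T where "T = root ?n (q / M)"
    have T: "T \<ge> 0" "T ^ ?n = q / M"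
      using real M by (auto simp: T_def)
    have "g r * indicator W (r, y) \<le> g r * indicator {0..T} r" for r
    proof (cases "(r, y) \<in> W")
      case True
      then have "0 \<le> r" "ennreal (r ^ ?n * M) \<le> ennreal q"
        using f_ge[of r y] real(2) by (auto simp: W_def)
      then have "r ^ ?n \<le> T ^ ?n"
        using M real(1) by (simp add: T(2) pos_le_divide_eq)
      then have "r \<le> T" using T(1) \<open>0 \<le> r\<close> by simp
      then show ?thesis using \<open>0 \<le> r\<close> True by simp
    qed simp
    then have "(\<integral>\<^sup>+r. g r * indicator W (r, y) \<partial>lborel) \<le> (\<integral>\<^sup>+r. g r * indicator {0..T} r \<partial>lborel)"
      by (rule nn_integral_mono)
    also have "\<dots> = ennreal (T ^ ?n)"
      unfolding g_def using T(1) by (intro nn_integral_power_Icc) auto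
    also have "\<dots> = f y * ennreal (1 / M)"
      using real M by (simp add: T(2) ennreal_mult[symmetric])
    finally show ?thesis .
  next
    case top
    then show ?thesis using M by (simp add: ennreal_top_mult)
  qed
  have g_meas [measurable]: "g \<in> borel_measurable borel" unfolding g_def by measurable
  have "(\<integral>\<^sup>+r. ennreal (?n * r ^ (?n - 1) * measure lebesgue (S r)) * indicator {0..min s t} r \<partial>lborel) =
      (\<integral>\<^sup>+r. \<integral>\<^sup>+y. g r * indicator W (r, y) \<partial>lborel \<partial>lborel)"
  proof (intro nn_integral_cong)
    fix r :: real
    have cS: "compact (S r)" unfolding S by (rule compact_minkowski_comb[OF cA cB])
    have "(\<integral>\<^sup>+y. g r * indicator W (r, y) \<partial>lborel) = (\<integral>\<^sup>+y. (g r * indicator {0..min s t} r) * indicator (S r) y \<partial>lborel)"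
      by (intro nn_integral_cong) (auto simp: W_def indicator_def)
    also have "\<dots> = g r * indicator {0..min s t} r * emeasure lborel (S r)"
      using borel_compact[OF cS] by (simp add: nn_integral_cmult_indicator)
    also have "\<dots> = ennreal (?n * r ^ (?n - 1) * measure lebesgue (S r)) * indicator {0..min s t} r"
      using emeasure_lborel_affine_compact[OF cS, of 1 0]
      by (cases "r \<ge> 0") (auto simp: g_def ennreal_mult indicator_def)
    finally show "ennreal (?n * r ^ (?n - 1) * measure lebesgue (S r)) * indicator {0..min s t} r =
        (\<integral>\<^sup>+y. g r * indicator W (r, y) \<partial>lborel)" by simp
  qed
  also have "\<dots> = (\<integral>\<^sup>+y. \<integral>\<^sup>+r. g r * indicator W (r, y) \<partial>lborel \<partial>lborel)"
  proof (rule nn_integral_lborel_swap)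
    have "(\<lambda>z. g (fst z) * indicator W z) \<in> borel_measurable (borel \<Otimes>\<^sub>M borel)"
      using W by measurable
    then show "(\<lambda>(r, y). g r * indicator W (r, y)) \<in> borel_measurable (borel \<Otimes>\<^sub>M borel)"
      by (simp add: case_prod_unfold)
  qed
  also have "\<dots> \<le> (\<integral>\<^sup>+y. f y * ennreal (1 / M) \<partial>lborel)"
    by (intro nn_integral_mono inner)
  also have "\<dots> = (\<integral>\<^sup>+y. f y \<partial>lborel) * ennreal (1 / M)"
  proof (rule nn_integral_multc)
    have "(\<lambda>y. \<integral>\<^sup>+x. indicator Z (y, x) \<partial>lborel) \<in> borel_measurable lborel"
      using Z by (intro lborel.borel_measurable_nn_integral) (simp add: case_prod_unfold)
    then show "f \<in> borel_measurable lborel" by (simp add: f_eq[abs_def])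
  qed
  also have "\<dots> = ennreal (s ^ ?n * t ^ ?N * M ^ CARD('p))"
    unfolding f_integral using st M by (simp add: ennreal_mult[symmetric] mult_ac)
  finally show ?thesis by (simp add: M_def)
qed

section \<open>Laplace transforms\<close>

lemma has_bochner_integral_power_times_exp:
  fixes \<beta> :: real
  assumes "\<beta> > 0"
  shows "has_bochner_integral lborel (\<lambda>x. x ^ k * exp (- \<beta> * x) * indicator {0..} x) (fact k / \<beta> ^ Suc k)"
proof -
  have "has_bochner_integral lborel (\<lambda>x :: real. x ^ k * exp (- x) * indicator {0..} x) (fact k)"
  proof (rule has_bochner_integral_nn_integral)
    have "(\<integral>\<^sup>+x. ennreal (x ^ k * exp (- x) * indicator {0..} x) \<partial>lborel) =
        (\<integral>\<^sup>+x. ennreal (x ^ k * exp (- x)) * indicator {0..} x \<partial>lborel)"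
      by (intro nn_integral_cong) (simp add: indicator_def)
    then show "(\<integral>\<^sup>+x. ennreal (x ^ k * exp (- x) * indicator {0..} x) \<partial>lborel) = ennreal (fact k)"
      by (simp add: nn_intergal_power_times_exp_Ici)
  qed (auto simp: indicator_def)
  from lborel_has_bochner_integral_real_affine_iff[of \<beta>, THEN iffD1, OF _ this, of 0]
  have "has_bochner_integral lborel
      (\<lambda>x. (\<beta> * x) ^ k * exp (- (\<beta> * x)) * indicator {0..} (\<beta> * x)) (fact k / \<beta>)"
    using assms by (simp add: divide_inverse mult.commute)
  from has_bochner_integral_mult_right[OF this, of "1 / \<beta> ^ k"]
  have "has_bochner_integral lborel
      (\<lambda>x. 1 / \<beta> ^ k * ((\<beta> * x) ^ k * exp (- (\<beta> * x)) * indicator {0..} (\<beta> * x))) (fact k / \<beta> ^ Suc k)"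
    by (simp add: mult.commute)
  also have "(\<lambda>x. 1 / \<beta> ^ k * ((\<beta> * x) ^ k * exp (- (\<beta> * x)) * indicator {0..} (\<beta> * x))) =
      (\<lambda>x. x ^ k * exp (- \<beta> * x) * indicator {0..} x)"
    using assms by (auto simp: fun_eq_iff indicator_def power_mult_distrib zero_le_mult_iff)
  finally show ?thesis .
qed

text \<open>Nonnegativity allows the transform to be written as a nonnegative integral, so that
  later exchanges of the order of integration require only measurability.\<close>

lemma laplace_transform_polynomial:
  fixes a :: "nat \<Rightarrow> real"
  assumes "\<beta> > 0" and nonneg: "\<And>x. x \<ge> 0 \<Longrightarrow> (\<Sum>j\<in>I. a j * x ^ k j) \<ge> 0"
  shows "(\<integral>\<^sup>+x. ennreal (exp (- \<beta> * x) * (\<Sum>j\<in>I. a j * x ^ k j)) * indicator {0..} x \<partial>lborel) =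
      ennreal (\<Sum>j\<in>I. a j * (fact (k j) / \<beta> ^ Suc (k j)))"
    and "(\<Sum>j\<in>I. a j * (fact (k j) / \<beta> ^ Suc (k j))) \<ge> 0"
proof -
  let ?f = "\<lambda>x. exp (- \<beta> * x) * (\<Sum>j\<in>I. a j * x ^ k j) * indicator {0..} x"
  have "has_bochner_integral lborel (\<lambda>x. \<Sum>j\<in>I. a j * (x ^ k j * exp (- \<beta> * x) * indicator {0..} x))
      (\<Sum>j\<in>I. a j * (fact (k j) / \<beta> ^ Suc (k j)))"
    by (intro has_bochner_integral_sum has_bochner_integral_mult_right has_bochner_integral_power_times_exp assms(1))
  also have "(\<lambda>x. \<Sum>j\<in>I. a j * (x ^ k j * exp (- \<beta> * x) * indicator {0..} x)) = ?f"
    by (simp add: fun_eq_iff sum_distrib_left sum_distrib_right mult_ac)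
  finally have f: "has_bochner_integral lborel ?f (\<Sum>j\<in>I. a j * (fact (k j) / \<beta> ^ Suc (k j)))" .
  have f_nonneg: "?f x \<ge> 0" for x
    using nonneg[of x] by (auto simp: indicator_def)
  show "(\<Sum>j\<in>I. a j * (fact (k j) / \<beta> ^ Suc (k j))) \<ge> 0"
    using has_bochner_integral_integral_eq[OF f] integral_nonneg_AE[of ?f lborel] f_nonneg by simp
  have "(\<integral>\<^sup>+x. ennreal (?f x) \<partial>lborel) = ennreal (\<Sum>j\<in>I. a j * (fact (k j) / \<beta> ^ Suc (k j)))"
    using nn_integral_eq_integral[OF integrable.intros[OF f]] f_nonneg
      has_bochner_integral_integral_eq[OF f] by simp
  also have "(\<integral>\<^sup>+x. ennreal (?f x) \<partial>lborel) =
      (\<integral>\<^sup>+x. ennreal (exp (- \<beta> * x) * (\<Sum>j\<in>I. a j * x ^ k j)) * indicator {0..} x \<partial>lborel)"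
    by (intro nn_integral_cong) (simp add: indicator_def)
  finally show "(\<integral>\<^sup>+x. ennreal (exp (- \<beta> * x) * (\<Sum>j\<in>I. a j * x ^ k j)) * indicator {0..} x \<partial>lborel) =
      ennreal (\<Sum>j\<in>I. a j * (fact (k j) / \<beta> ^ Suc (k j)))" .
qed

lemma laplace_transform_two_variables:
  fixes d :: "nat \<Rightarrow> real"
  assumes "x > 0" and nonneg: "\<And>s t. s \<ge> 0 \<Longrightarrow> t \<ge> 0 \<Longrightarrow> (\<Sum>j\<in>I. d j * s ^ k j * t ^ l j) \<ge> 0"
  shows "(\<integral>\<^sup>+s. \<integral>\<^sup>+t. ennreal (exp (- s - x * t) * (\<Sum>j\<in>I. d j * s ^ k j * t ^ l j)) *
        indicator {0..} s * indicator {0..} t \<partial>lborel \<partial>lborel) =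
      ennreal (\<Sum>j\<in>I. d j * fact (k j) * fact (l j) / x ^ Suc (l j))" (is "?L = ennreal ?R")
    and "(\<Sum>j\<in>I. d j * fact (k j) * fact (l j) / x ^ Suc (l j)) \<ge> 0"
proof -
  let ?a = "\<lambda>j. d j * (fact (l j) / x ^ Suc (l j))"
  have inner: "(\<integral>\<^sup>+t. ennreal (exp (- x * t) * (\<Sum>j\<in>I. d j * s ^ k j * t ^ l j)) * indicator {0..} t \<partial>lborel) =
      ennreal (\<Sum>j\<in>I. d j * s ^ k j * (fact (l j) / x ^ Suc (l j)))"
    "0 \<le> (\<Sum>j\<in>I. d j * s ^ k j * (fact (l j) / x ^ Suc (l j)))" if "s \<ge> 0" for s
    using laplace_transform_polynomial[OF assms(1), where a="\<lambda>j. d j * s ^ k j" and k=l and I=I]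
      nonneg[OF that] by blast+
  have outer_nonneg: "(\<Sum>j\<in>I. ?a j * s ^ k j) \<ge> 0" if "s \<ge> 0" for s
    using inner(2)[OF that] by (simp add: mult_ac)
  have outer: "(\<integral>\<^sup>+s. ennreal (exp (- 1 * s) * (\<Sum>j\<in>I. ?a j * s ^ k j)) * indicator {0..} s \<partial>lborel) =
      ennreal (\<Sum>j\<in>I. ?a j * (fact (k j) / 1 ^ Suc (k j)))"
    "0 \<le> (\<Sum>j\<in>I. ?a j * (fact (k j) / 1 ^ Suc (k j)))"
    using laplace_transform_polynomial[where \<beta>=1 and k=k and I=I and a="?a", OF zero_less_one]
      outer_nonneg by blast+
  show "(\<Sum>j\<in>I. d j * fact (k j) * fact (l j) / x ^ Suc (l j)) \<ge> 0"
    using outer(2) by (simp add: mult_ac)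
  have "?L = (\<integral>\<^sup>+s. ennreal (exp (- 1 * s) * (\<Sum>j\<in>I. ?a j * s ^ k j)) * indicator {0..} s \<partial>lborel)"
  proof (rule nn_integral_cong)
    fix s :: real
    let ?h = "\<lambda>t. \<Sum>j\<in>I. d j * s ^ k j * t ^ l j"
    show "(\<integral>\<^sup>+t. ennreal (exp (- s - x * t) * ?h t) * indicator {0..} s * indicator {0..} t \<partial>lborel) =
      ennreal (exp (- 1 * s) * (\<Sum>j\<in>I. ?a j * s ^ k j)) * indicator {0..} s"
    proof (cases "s \<ge> 0")
      case True
      have "(\<integral>\<^sup>+t. ennreal (exp (- s - x * t) * ?h t) * indicator {0..} s * indicator {0..} t \<partial>lborel) =
          (\<integral>\<^sup>+t. ennreal (exp (- s)) * (ennreal (exp (- x * t) * ?h t) * indicator {0..} t) \<partial>lborel)"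
        using nonneg[OF True] True
        by (intro nn_integral_cong) (auto simp: indicator_def ennreal_mult[symmetric] exp_diff exp_minus field_simps)
      also have "\<dots> = ennreal (exp (- s)) * ennreal (\<Sum>j\<in>I. d j * s ^ k j * (fact (l j) / x ^ Suc (l j)))"
        unfolding inner(1)[OF True, symmetric] by (rule nn_integral_cmult) measurable
      also have "\<dots> = ennreal (exp (- 1 * s) * (\<Sum>j\<in>I. ?a j * s ^ k j)) * indicator {0..} s"
        using True outer_nonneg[OF True] by (simp add: ennreal_mult[symmetric] mult_ac)
      finally show ?thesis .
    qed simp
  qed
  also have "\<dots> = ennreal ?R"
    unfolding outer(1) by (simp add: mult_ac)
  finally show "?L = ennreal ?R" .
qed

lemma nn_integral_translate:
  fixes f :: "real \<Rightarrow> ennreal"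
  assumes [measurable]: "f \<in> borel_measurable borel"
  shows "(\<integral>\<^sup>+s. f (s - r) \<partial>lborel) = (\<integral>\<^sup>+s. f s \<partial>lborel)"
  using nn_integral_real_affine[OF assms, of 1 "- r"] by simp

text \<open>Integrating the hypothesis against \<open>exp (- s - x t)\<close> turns the convolution on its left-hand
  side into a product, by Fubini and the translation \<open>(s, t) \<mapsto> (s - r, t - r)\<close>.\<close>

lemma laplace_transform_bound:
  fixes d :: "nat \<Rightarrow> real" and N :: nat
  defines "F s t \<equiv> (\<Sum>j\<le>N. d j * s ^ j * t ^ (N - j))"
  assumes "n > 0" "C \<ge> 0" "x > 0"
    and nonneg: "\<And>s t. s \<ge> 0 \<Longrightarrow> t \<ge> 0 \<Longrightarrow> F s t \<ge> 0"
    and bound: "\<And>s t. s \<ge> 0 \<Longrightarrow> t \<ge> 0 \<Longrightarrow>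
      (\<integral>\<^sup>+r. ennreal (n * r ^ (n - 1) * F (s - r) (t - r)) * indicator {0..min s t} r \<partial>lborel)
        \<le> ennreal (s ^ n * t ^ N * C)"
  shows "0 \<le> (\<Sum>j\<le>N. d j * fact j * fact (N - j) * x ^ j)"
    and "(\<Sum>j\<le>N. d j * fact j * fact (N - j) * x ^ j) \<le> C * fact N * (1 + x) ^ n"
proof -
  define D where "D = (\<Sum>j\<le>N. d j * fact j * fact (N - j) * x ^ j)"
  \<comment> \<open>The indicators in \<open>G\<close> extend the integrand by 0 to the whole plane,
    where translation is free. The weight \<open>w\<close> contains exp (-(1 + x) r), the factor
    left over when both variables are shifted by \<open>r\<close>.\<close>
  define G where "G s t = ennreal (exp (- s - x * t) * F s t) * indicator {0..} s * indicator {0..} t" for s t :: real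
  define w where "w r = ennreal (n * r ^ (n - 1) * exp (- (1 + x) * r)) * indicator {0..} r" for r :: real
  have [measurable]: "(\<lambda>z. F (f z) (g z)) \<in> borel_measurable M"
    if [measurable]: "f \<in> borel_measurable M" "g \<in> borel_measurable M" for f g :: "'z \<Rightarrow> real" and M
    unfolding F_def by measurable
  have G_meas [measurable]: "(\<lambda>z. G (f z) (g z)) \<in> borel_measurable M"
    if [measurable]: "f \<in> borel_measurable M" "g \<in> borel_measurable M" for f g :: "'z \<Rightarrow> real" and M
    unfolding G_def by measurable
  have w_meas [measurable]: "w \<in> borel_measurable borel" unfolding w_def by measurable
  have D_eq: "(\<Sum>j\<le>N. d j * fact j * fact (N - j) / x ^ Suc (N - j)) = D / x ^ Suc N"
    unfolding D_def sum_divide_distrib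
    using assms(4) by (intro sum.cong refl) (simp add: power_diff field_simps)
  have J: "(\<integral>\<^sup>+s. \<integral>\<^sup>+t. G s t \<partial>lborel \<partial>lborel) = ennreal (D / x ^ Suc N)" "0 \<le> D / x ^ Suc N"
    using laplace_transform_two_variables[where k="\<lambda>j. j" and l="\<lambda>j. N - j" and I="{..N}" and d=d,
        OF assms(4)] nonneg
    unfolding G_def F_def D_eq by blast+
  have "0 \<le> D / x ^ Suc N * x ^ Suc N" using J(2) assms(4) by (intro mult_nonneg_nonneg) auto
  then have "D \<ge> 0" using assms(4) by simp
  then show "0 \<le> (\<Sum>j\<le>N. d j * fact j * fact (N - j) * x ^ j)" by (simp add: D_def)
  have w_integral: "(\<integral>\<^sup>+r. w r \<partial>lborel) = ennreal (fact n / (1 + x) ^ n)"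
  proof -
    \<comment> \<open>The one-term sum only gives the integrand the form expected by
      \<open>laplace_transform_polynomial\<close>; a similar sum below serves
      \<open>laplace_transform_two_variables\<close>.\<close>
    have "(\<integral>\<^sup>+r. w r \<partial>lborel) =
        (\<integral>\<^sup>+r. ennreal (exp (- (1 + x) * r) * (\<Sum>j\<in>{0 :: nat}. real n * r ^ (n - 1))) * indicator {0..} r \<partial>lborel)"
      unfolding w_def by (intro nn_integral_cong) (simp add: mult_ac)
    also have "\<dots> = ennreal (\<Sum>j\<in>{0 :: nat}. real n * (fact (n - 1) / (1 + x) ^ Suc (n - 1)))"
      using assms(4) by (intro laplace_transform_polynomial) auto
    also have "\<dots> = ennreal (fact n / (1 + x) ^ n)"
      using assms(2) fact_reduce[of n, where 'a=real] by simp
    finally show ?thesis .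
  qed
  \<comment> \<open>Outside 0 <= r <= min s t both sides vanish: on the left through the indicators
    in \<open>w\<close> and \<open>G\<close>, on the right through the last one.\<close>
  have split: "w r * G (s - r) (t - r) =
      ennreal (exp (- s - x * t)) * indicator {0..} s * indicator {0..} t *
      (ennreal (n * r ^ (n - 1) * F (s - r) (t - r)) * indicator {0..min s t} r)" for s t r :: real
  proof (cases "0 \<le> r \<and> r \<le> s \<and> r \<le> t")
    case True
    have e: "exp (- (1 + x) * r) * exp (- (s - r) - x * (t - r)) = exp (- s - x * t)"
      by (simp add: exp_add[symmetric] algebra_simps)
    have "real n * r ^ (n - 1) * exp (- (1 + x) * r) * (exp (- (s - r) - x * (t - r)) * F (s - r) (t - r)) =
        (exp (- (1 + x) * r) * exp (- (s - r) - x * (t - r))) * (n * r ^ (n - 1) * F (s - r) (t - r))"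
      by (simp only: mult_ac)
    also have "\<dots> = exp (- s - x * t) * (n * r ^ (n - 1) * F (s - r) (t - r))"
      by (simp only: e)
    finally have eq: "real n * r ^ (n - 1) * exp (- (1 + x) * r) * (exp (- (s - r) - x * (t - r)) * F (s - r) (t - r)) =
        exp (- s - x * t) * (n * r ^ (n - 1) * F (s - r) (t - r))" .
    have pos: "0 \<le> F (s - r) (t - r)" using True by (intro nonneg) auto
    have ind: "indicator {0..} s = (1 :: ennreal)" "indicator {0..} t = (1 :: ennreal)"
      "indicator {0..} r = (1 :: ennreal)" "indicator {0..} (s - r) = (1 :: ennreal)"
      "indicator {0..} (t - r) = (1 :: ennreal)" "indicator {0..min s t} r = (1 :: ennreal)"
      using True by auto
    have "w r * G (s - r) (t - r) = ennreal (real n * r ^ (n - 1) * exp (- (1 + x) * r) *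
        (exp (- (s - r) - x * (t - r)) * F (s - r) (t - r)))"
      unfolding w_def G_def ind mult_1_right using True pos by (intro ennreal_mult[symmetric]) auto
    also have "\<dots> = ennreal (exp (- s - x * t)) * ennreal (n * r ^ (n - 1) * F (s - r) (t - r))"
      unfolding eq using True pos by (intro ennreal_mult) auto
    finally show ?thesis
      by (simp only: ind mult_1_right)
  qed (auto simp: w_def G_def indicator_def)
  have "ennreal (fact n / (1 + x) ^ n * (D / x ^ Suc N)) = (\<integral>\<^sup>+r. w r \<partial>lborel) * (\<integral>\<^sup>+s. \<integral>\<^sup>+t. G s t \<partial>lborel \<partial>lborel)"
    unfolding w_integral J(1) using \<open>D \<ge> 0\<close> assms(4) by (intro ennreal_mult) auto
  also have "\<dots> = (\<integral>\<^sup>+r. w r * (\<integral>\<^sup>+s. \<integral>\<^sup>+t. G s t \<partial>lborel \<partial>lborel) \<partial>lborel)"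
    by (rule nn_integral_multc[symmetric]) measurable
  also have "\<dots> = (\<integral>\<^sup>+r. \<integral>\<^sup>+s. \<integral>\<^sup>+t. w r * G (s - r) (t - r) \<partial>lborel \<partial>lborel \<partial>lborel)"
  proof (rule nn_integral_cong)
    fix r
    have "(\<integral>\<^sup>+s. \<integral>\<^sup>+t. w r * G (s - r) (t - r) \<partial>lborel \<partial>lborel) =
        w r * (\<integral>\<^sup>+s. \<integral>\<^sup>+t. G (s - r) (t - r) \<partial>lborel \<partial>lborel)"
      by (simp add: nn_integral_cmult)
    also have "(\<integral>\<^sup>+s. \<integral>\<^sup>+t. G (s - r) (t - r) \<partial>lborel \<partial>lborel) = (\<integral>\<^sup>+s. \<integral>\<^sup>+t. G (s - r) t \<partial>lborel \<partial>lborel)"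
      by (intro nn_integral_cong nn_integral_translate) measurable
    also have "\<dots> = (\<integral>\<^sup>+s. \<integral>\<^sup>+t. G s t \<partial>lborel \<partial>lborel)"
      by (rule nn_integral_translate) measurable
    finally show "w r * (\<integral>\<^sup>+s. \<integral>\<^sup>+t. G s t \<partial>lborel \<partial>lborel) = (\<integral>\<^sup>+s. \<integral>\<^sup>+t. w r * G (s - r) (t - r) \<partial>lborel \<partial>lborel)" ..
  qed
  also have "\<dots> = (\<integral>\<^sup>+s. \<integral>\<^sup>+r. \<integral>\<^sup>+t. w r * G (s - r) (t - r) \<partial>lborel \<partial>lborel \<partial>lborel)"
    by (rule nn_integral_lborel_swap) measurable
  also have "\<dots> = (\<integral>\<^sup>+s. \<integral>\<^sup>+t. \<integral>\<^sup>+r. w r * G (s - r) (t - r) \<partial>lborel \<partial>lborel \<partial>lborel)"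
    by (intro nn_integral_cong nn_integral_lborel_swap) measurable
  also have "\<dots> \<le> (\<integral>\<^sup>+s. \<integral>\<^sup>+t. ennreal (exp (- s - x * t) * (\<Sum>j\<in>{0 :: nat}. C * s ^ n * t ^ N)) *
      indicator {0..} s * indicator {0..} t \<partial>lborel \<partial>lborel)"
  proof (intro nn_integral_mono)
    fix s t :: real
    let ?e = "ennreal (exp (- s - x * t)) * indicator {0..} s * indicator {0..} t"
    have "(\<integral>\<^sup>+r. w r * G (s - r) (t - r) \<partial>lborel) =
        ?e * (\<integral>\<^sup>+r. ennreal (n * r ^ (n - 1) * F (s - r) (t - r)) * indicator {0..min s t} r \<partial>lborel)"
      unfolding split by (rule nn_integral_cmult) measurable
    also have "\<dots> \<le> ?e * ennreal (s ^ n * t ^ N * C)"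
      using bound[of s t] by (cases "s \<ge> 0 \<and> t \<ge> 0") (auto intro: mult_left_mono)
    also have "\<dots> = ennreal (exp (- s - x * t) * (\<Sum>j\<in>{0 :: nat}. C * s ^ n * t ^ N)) *
      indicator {0..} s * indicator {0..} t"
      using assms(3) by (auto simp: indicator_def ennreal_mult[symmetric] mult_ac)
    finally show "(\<integral>\<^sup>+r. w r * G (s - r) (t - r) \<partial>lborel) \<le> ennreal (exp (- s - x * t) * (\<Sum>j\<in>{0 :: nat}. C * s ^ n * t ^ N)) *
      indicator {0..} s * indicator {0..} t" .
  qed
  also have "\<dots> = ennreal (C * fact n * fact N / x ^ Suc N)"
    using laplace_transform_two_variables(1)[OF assms(4), where I="{0 :: nat}" and d="\<lambda>_. C" and k="\<lambda>_. n" and l="\<lambda>_. N"] assms(3) by simp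
  finally have "fact n / (1 + x) ^ n * (D / x ^ Suc N) \<le> C * fact n * fact N / x ^ Suc N"
    using assms(3,4) by simp
  then have "D \<le> C * fact N * (1 + x) ^ n"
    using assms(4) by (simp add: field_simps)
  then show "(\<Sum>j\<le>N. d j * fact j * fact (N - j) * x ^ j) \<le> C * fact N * (1 + x) ^ n"
    by (simp add: D_def)
qed

section \<open>From growth bounds to the weighted sum\<close>

text \<open>The reflected polynomial h^d p(1/h), with d the degree of \<open>p\<close>, tends to the
  leading coefficient as h decreases to 0. If d > n, it lies between 0 and C h^(d-n) (1 + h)^n,
  which forces that coefficient to be 0.\<close>

lemma degree_le_of_growth:
  fixes p :: "real poly"
  assumes "\<And>x. x > 0 \<Longrightarrow> 0 \<le> poly p x" "\<And>x. x > 0 \<Longrightarrow> poly p x \<le> C * (1 + x) ^ n"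
  shows "degree p \<le> n"
proof (rule ccontr)
  assume "\<not> degree p \<le> n"
  then have d: "degree p > n" by simp
  have eq: "poly (reflect_poly p) h = h ^ degree p * poly p (1 / h)" if "h > 0" for h
    using that by (simp add: poly_reflect_poly_nz inverse_eq_divide)
  have "((\<lambda>h. C * h ^ (degree p - n) * (1 + h) ^ n) \<longlongrightarrow> C * 0 ^ (degree p - n) * (1 + 0) ^ n) (at_right 0)"
    by (intro tendsto_intros)
  moreover have "(0::real) ^ (degree p - n) = 0" using d by simp
  ultimately have upper: "((\<lambda>h. C * h ^ (degree p - n) * (1 + h) ^ n) \<longlongrightarrow> 0) (at_right 0)"
    by simp
  have "(poly (reflect_poly p) \<longlongrightarrow> 0) (at_right 0)"
  proof (rule tendsto_sandwich[OF _ _ tendsto_const upper])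
    show "\<forall>\<^sub>F h in at_right 0. 0 \<le> poly (reflect_poly p) h"
      using eventually_at_right_less by eventually_elim (simp add: eq assms(1))
    show "\<forall>\<^sub>F h in at_right 0. poly (reflect_poly p) h \<le> C * h ^ (degree p - n) * (1 + h) ^ n"
      using eventually_at_right_less
    proof eventually_elim
      case (elim h)
      have "h ^ degree p * poly p (1 / h) \<le> h ^ degree p * (C * (1 + 1 / h) ^ n)"
        using elim by (intro mult_left_mono assms(2)) auto
      also have "\<dots> = C * h ^ (degree p - n) * (h * (1 + 1 / h)) ^ n"
        using d by (simp add: power_mult_distrib power_add[symmetric] mult_ac)
      also have "h * (1 + 1 / h) = 1 + h" using elim by (simp add: field_simps)
      finally show ?case using elim by (simp add: eq)
    qed
  qed
  moreover have "(poly (reflect_poly p) \<longlongrightarrow> poly (reflect_poly p) 0) (at_right 0)"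
    by (intro tendsto_intros)
  ultimately have "poly (reflect_poly p) 0 = 0"
    using tendsto_unique trivial_limit_at_right_real by blast
  then show False using d by auto
qed

text \<open>On the open interval both bases are positive, so \<open>powr\<close> agrees with the
  natural power even for exponent 0, which fails at the endpoints.\<close>

lemma has_integral_Beta_nat:
  "((\<lambda>u::real. u ^ a * (1 - u) ^ b) has_integral (fact a * fact b / fact (a + b + 1))) {0<..<1}"
proof -
  have "((\<lambda>u::real. u powr (real a + 1 - 1) * (1 - u) powr (real b + 1 - 1)) has_integral
      Beta (real a + 1) (real b + 1)) {0<..<1}"
    using has_integral_Beta_real[of "real a + 1" "real b + 1"] by (simp add: has_integral_Icc_iff_Ioo)
  moreover have "Beta (real a + 1) (real b + 1) = fact a * fact b / fact (a + b + 1)"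
    using Gamma_fact[of a, where 'a=real] Gamma_fact[of b, where 'a=real] Gamma_fact[of "a + b + 1", where 'a=real]
    by (simp add: Beta_def add_ac)
  ultimately have "((\<lambda>u::real. u powr (real a + 1 - 1) * (1 - u) powr (real b + 1 - 1)) has_integral
      (fact a * fact b / fact (a + b + 1))) {0<..<1}" by simp
  then show ?thesis
    by (rule has_integral_eq[rotated]) (simp add: powr_realpow)
qed

theorem corollary1p6:
  fixes K :: "(real ^ 'n) set"
  assumes "CARD('n) \<ge> 2"
    and "convex_body K"
  shows "1 / real (CARD('n) + 1) *
      (\<Sum>j = 0..CARD('n). inverse (real (CARD('n) choose j)) *
         mixed_volume
           (replicate j (uminus ` (diagonal_embedding ` K :: (real ^ 'n ^ 'p) set)) @
            replicate (CARD('n) * CARD('p) - j) (cartesian_power K :: (real ^ 'n ^ 'p) set)))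
    \<le> measure lebesgue K ^ CARD('p)"
proof -
  let ?n = "CARD('n)" and ?N = "CARD('n) * CARD('p)"
  define A where "A = (uminus ` diagonal_embedding ` K :: (real ^ 'n ^ 'p) set)"
  define B where "B = (cartesian_power K :: (real ^ 'n ^ 'p) set)"
  define V where "V j = mixed_volume (replicate j A @ replicate (?N - j) B)" for j
  define C where "C = measure lebesgue K ^ CARD('p)"
  have A: "convex_body A" and B: "convex_body B"
    unfolding A_def B_def
    by (intro convex_body_uminus_diagonal convex_body_cartesian_power assms)+
  have N: "DIM(real ^ 'n ^ 'p) = ?N" by (simp add: mult.commute)
  have vol: "measure lebesgue (minkowski_comb s A t B) = (\<Sum>j\<le>?N. (?N choose j) * V j * s ^ j * t ^ (?N - j))"
    if "s \<ge> 0" "t \<ge> 0" for s t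
    using measure_minkowski_comb_mixed_volume[OF A B that] unfolding N V_def .
  have bound: "(\<integral>\<^sup>+r. ennreal (?n * r ^ (?n - 1) *
      (\<Sum>j\<le>?N. (?N choose j) * V j * (s - r) ^ j * (t - r) ^ (?N - j))) * indicator {0..min s t} r \<partial>lborel)
      \<le> ennreal (s ^ ?n * t ^ ?N * C)" if st: "s \<ge> 0" "t \<ge> 0" for s t
  proof -
    \<comment> \<open>The polynomial equals the volume only for nonnegative arguments; for all other
      \<open>r\<close> the indicator is 0.\<close>
    have "ennreal (?n * r ^ (?n - 1) *
        (\<Sum>j\<le>?N. (?N choose j) * V j * (s - r) ^ j * (t - r) ^ (?N - j))) * indicator {0..min s t} r =
        ennreal (?n * r ^ (?n - 1) * measure lebesgue (minkowski_comb (s - r) A (t - r) B)) * indicator {0..min s t} r" for r :: real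
      using vol[of "s - r" "t - r"] by (cases "r \<in> {0..min s t}") auto
    then show ?thesis
      using nn_integral_minkowski_comb_diagonal_le[OF assms(2) st, where 'p='p]
      by (simp only: A_def[symmetric] B_def[symmetric] C_def)
  qed
  have nonneg: "0 \<le> (\<Sum>j\<le>?N. (?N choose j) * V j * s ^ j * t ^ (?N - j))" if "s \<ge> 0" "t \<ge> 0" for s t
    using vol[OF that] measure_nonneg by metis
  have C: "C \<ge> 0" by (simp add: C_def)
  \<comment> \<open>The factorials produced by the Laplace transform cancel the binomial
    coefficients up to a common factor N!.\<close>
  have fact_N: "(\<Sum>j\<le>?N. (?N choose j) * V j * fact j * fact (?N - j) * x ^ j) = fact ?N * (\<Sum>j\<le>?N. V j * x ^ j)" for x
    unfolding sum_distrib_left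
    by (intro sum.cong refl) (simp add: binomial_fact)
  have poly_bounds: "0 \<le> (\<Sum>j\<le>?N. V j * x ^ j)" "(\<Sum>j\<le>?N. V j * x ^ j) \<le> C * (1 + x) ^ ?n" if "x > 0" for x
    using laplace_transform_bound[OF zero_less_card_finite C that nonneg bound]
    unfolding fact_N by (simp_all add: zero_le_mult_iff mult_ac not_le[THEN iffD2, OF fact_gt_zero])
  \<comment> \<open>The sum runs up to N but grows at most like (1 + x)^n, so all mixed volumes with
    index above n vanish. This allows the sum to be cut at n.\<close>
  define q where "q = (\<Sum>j\<le>?N. monom (V j) j)"
  have q: "poly q x = (\<Sum>j\<le>?N. V j * x ^ j)" for x
    by (simp add: q_def poly_sum poly_monom)
  have "degree q \<le> ?n"
    by (rule degree_le_of_growth) (use poly_bounds q in auto)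
  moreover have "coeff q j = V j" if "j \<le> ?N" for j
    using that by (simp add: q_def coeff_sum)
  ultimately have V_0: "V j = 0" if "?n < j" "j \<le> ?N" for j
    using that coeff_eq_0[of q j] by simp
  have le: "(\<Sum>j\<le>?n. V j * (u ^ (?n - j) * (1 - u) ^ j)) \<le> C" if u: "u \<in> {0<..<1}" for u
  proof -
    \<comment> \<open>With this choice 1 + x = 1/u, so multiplying by u^n turns the bound into the
      constant \<open>C\<close> and the powers of x into Beta integrands.\<close>
    let ?x = "(1 - u) / u"
    have x: "?x > 0" "1 + ?x = 1 / u" using u by (auto simp: field_simps)
    have "(\<Sum>j\<le>?n. V j * (u ^ (?n - j) * (1 - u) ^ j)) = u ^ ?n * (\<Sum>j\<le>?n. V j * ?x ^ j)"
      unfolding sum_distrib_left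
      using u by (intro sum.cong refl) (simp add: power_divide power_diff)
    also have "(\<Sum>j\<le>?n. V j * ?x ^ j) = (\<Sum>j\<le>?N. V j * ?x ^ j)"
      by (intro sum.mono_neutral_left) (auto simp: V_0)
    also have "u ^ ?n * \<dots> \<le> u ^ ?n * (C * (1 / u) ^ ?n)"
      using poly_bounds(2)[OF x(1)] u unfolding x(2) by (intro mult_left_mono) auto
    also have "\<dots> = C" using u by (simp add: power_divide)
    finally show ?thesis .
  qed
  have "((\<lambda>u. \<Sum>j\<le>?n. V j * (u ^ (?n - j) * (1 - u) ^ j)) has_integral
      (\<Sum>j\<le>?n. V j * (fact (?n - j) * fact j / fact (?n - j + j + 1)))) {0<..<1}"
    by (intro has_integral_sum has_integral_mult_right has_integral_Beta_nat) auto
  moreover have "((\<lambda>u::real. C) has_integral C) {0<..<1}"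
    using has_integral_const_real[of C 0 1] by (simp add: has_integral_Icc_iff_Ioo)
  ultimately have "(\<Sum>j\<le>?n. V j * (fact (?n - j) * fact j / fact (?n - j + j + 1))) \<le> C"
    using le by (rule has_integral_le)
  \<comment> \<open>The Beta weight (n - j)! j! / (n + 1)! is 1 / ((n + 1) (n choose j)).\<close>
  also have "(\<Sum>j\<le>?n. V j * (fact (?n - j) * fact j / fact (?n - j + j + 1))) =
      1 / real (?n + 1) * (\<Sum>j = 0..?n. inverse (real (?n choose j)) * V j)"
    unfolding sum_distrib_left atMost_atLeast0
    by (intro sum.cong refl) (simp add: binomial_fact field_simps)
  finally show ?thesis
    by (simp only: V_def A_def B_def C_def)
qed

end
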